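(* Let $\mathscr{H}$ be a complex Hilbert space, let $\mathcal{P}$ be the set of all invertible positive bounded linear operators on $\mathscr{H}$, let $m\ge1$, and let $A_j,B_j\in\mathcal{P}$ for $1\le j\le m$. Then for all $s\in[0,1]$, $$\sum_{j=1}^{m}(A_j\sharp B_j)\le\Big(\sum_{j=1}^{m}(A_j\sharp_sB_j)\Big)\sharp\Big(\sum_{j=1}^{m}(A_j\sharp_{1-s}B_j)\Big)\le\Big(\sum_{j=1}^{m}A_j\Big)\sharp\Big(\sum_{j=1}^{m}B_j\Big).$$ Moreover, for all $t\in[0,1]$ and all $s$ between $t$ and $1-t$ (that is, $\min\{t,1-t\}\le s\le\max\{t,1-t\}$), $$\Big(\sum_{j=1}^{m}(A_j\sharp_sB_j)\Big)\sharp\Big(\sum_{j=1}^{m}(A_j\sharp_{1-s}B_j)\Big)\le\Big(\sum_{j=1}^{m}(A_j\sharp_tB_j)\Big)\sharp\Big(\sum_{j=1}^{m}(A_j\sharp_{1-t}B_j)\Big).$$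
   Context: $\le$ is the Loewner order on self-adjoint operators ($X\le Y$ iff $Y-X$ is positive semidefinite). For $A,B\in\mathcal{P}$ and $0\le p\le1$, the weighted geometric mean is $A\sharp_pB=A^{1/2}(A^{-1/2}BA^{-1/2})^{p}A^{1/2}$, and the geometric mean is $A\sharp B=A\sharp_{1/2}B$. *)

theory Defs
  imports "HOL-Analysis.Analysis" "HOL-Computational_Algebra.Polynomial"
begin

text \<open>
  Complex Hilbert spaces of arbitrary dimension. The real scalar multiplication, norm and
  completeness come from \<^class>\<open>banach\<close>; the inner product is linear in its first argument, and the
  axiom \<open>cinner_self\<close> states both that it is positive definite and that it induces the norm.
\<close>

class chilbert_space = banach +
  fixes scaleC :: "complex \<Rightarrow> 'a \<Rightarrow> 'a" (infixr "*\<^sub>C" 75)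
    and cinner :: "'a \<Rightarrow> 'a \<Rightarrow> complex"
  assumes scaleC_add_right: "c *\<^sub>C (x + y) = c *\<^sub>C x + c *\<^sub>C y"
    and scaleC_add_left: "(c + d) *\<^sub>C x = c *\<^sub>C x + d *\<^sub>C x"
    and scaleC_scaleC: "c *\<^sub>C d *\<^sub>C x = (c * d) *\<^sub>C x"
    and scaleR_scaleC: "r *\<^sub>R x = complex_of_real r *\<^sub>C x"
    and cinner_add_left: "cinner (x + y) z = cinner x z + cinner y z"
    and cinner_scaleC_left: "cinner (c *\<^sub>C x) y = c * cinner x y"
    and cinner_commute: "cinner x y = cnj (cinner y x)"
    and cinner_self: "cinner x x = complex_of_real ((norm x)\<^sup>2)"

lemma norm_scaleC: "norm (c *\<^sub>C (x :: 'a :: chilbert_space)) = cmod c * norm x"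
proof -
  have "cinner (c *\<^sub>C x) (c *\<^sub>C x) = c * cnj c * cinner x x"
    by (metis cinner_scaleC_left cinner_commute complex_cnj_mult mult.assoc)
  then have "complex_of_real ((norm (c *\<^sub>C x))\<^sup>2) = complex_of_real ((cmod c * norm x)\<^sup>2)"
    by (simp add: cinner_self power_mult_distrib flip: complex_norm_square)
  then have "(norm (c *\<^sub>C x))\<^sup>2 = (cmod c * norm x)\<^sup>2"
    using of_real_eq_iff by blast
  then show ?thesis
    by simp
qed

lemma bounded_linear_scaleC: "bounded_linear (\<lambda>x :: 'a :: chilbert_space. c *\<^sub>C x)"
proof (rule bounded_linear_intro)
  show "c *\<^sub>C (r *\<^sub>R x) = r *\<^sub>R (c *\<^sub>C x)" for r and x :: 'a
    by (simp add: scaleR_scaleC scaleC_scaleC mult.commute)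
  show "norm (c *\<^sub>C x) \<le> norm x * cmod c" for x :: 'a
    by (simp add: norm_scaleC mult.commute)
qed (rule scaleC_add_right)

text \<open>
  The type \<open>'a \<Rightarrow>\<^sub>L 'a\<close> consists of the bounded real-linear operators; the bounded (complex-)linear
  operators are those satisfying the following predicate.
\<close>

definition complex_linear_op :: "('a::chilbert_space \<Rightarrow>\<^sub>L 'a) \<Rightarrow> bool" where
  "complex_linear_op T \<longleftrightarrow> (\<forall>c x. T (c *\<^sub>C x) = c *\<^sub>C T x)"

definition selfadjoint_op :: "('a::chilbert_space \<Rightarrow>\<^sub>L 'a) \<Rightarrow> bool" where
  "selfadjoint_op T \<longleftrightarrow> complex_linear_op T \<and> (\<forall>x y. cinner (T x) y = cinner x (T y))"

definition positive_op :: "('a::chilbert_space \<Rightarrow>\<^sub>L 'a) \<Rightarrow> bool" where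
  "positive_op T \<longleftrightarrow> selfadjoint_op T \<and> (\<forall>x. 0 \<le> Re (cinner (T x) x))"

definition loewner_le :: "('a::chilbert_space \<Rightarrow>\<^sub>L 'a) \<Rightarrow> ('a \<Rightarrow>\<^sub>L 'a) \<Rightarrow> bool" (infix "\<preceq>" 50) where
  "X \<preceq> Y \<longleftrightarrow> selfadjoint_op X \<and> selfadjoint_op Y \<and> positive_op (Y - X)"

definition invertible_op :: "('a::chilbert_space \<Rightarrow>\<^sub>L 'a) \<Rightarrow> bool" where
  "invertible_op T \<longleftrightarrow>
    (\<exists>S. complex_linear_op S \<and> S o\<^sub>L T = id_blinfun \<and> T o\<^sub>L S = id_blinfun)"

definition invertible_positive_ops :: "('a::chilbert_space \<Rightarrow>\<^sub>L 'a) set" where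
  "invertible_positive_ops = {T. positive_op T \<and> invertible_op T}"

lift_definition scalar_op :: "complex \<Rightarrow> ('a::chilbert_space \<Rightarrow>\<^sub>L 'a)" is "\<lambda>c x. c *\<^sub>C x"
  by (rule bounded_linear_scaleC)

definition spectrum_op :: "('a::chilbert_space \<Rightarrow>\<^sub>L 'a) \<Rightarrow> complex set" where
  "spectrum_op T = {c. \<not> invertible_op (T - scalar_op c)}"

definition op_poly :: "real poly \<Rightarrow> ('a::chilbert_space \<Rightarrow>\<^sub>L 'a) \<Rightarrow> ('a \<Rightarrow>\<^sub>L 'a)" where
  "op_poly q T = (\<Sum>i\<le>degree q. coeff q i *\<^sub>R (((o\<^sub>L) T) ^^ i) id_blinfun)"

text \<open>
  Continuous functional calculus of a self-adjoint operator \<open>T\<close>: \<open>f(T)\<close> is the norm limit of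
  \<open>q\<^sub>n(T)\<close> for real polynomials \<open>q\<^sub>n\<close> converging to \<open>f\<close> uniformly on the spectrum. It is only meaningful
  for self-adjoint \<open>T\<close> (whose spectrum is real) and \<open>f\<close> continuous on the spectrum.
\<close>

definition op_calc :: "(real \<Rightarrow> real) \<Rightarrow> ('a::chilbert_space \<Rightarrow>\<^sub>L 'a) \<Rightarrow> ('a \<Rightarrow>\<^sub>L 'a)" where
  "op_calc f T = (THE S. \<exists>q :: nat \<Rightarrow> real poly.
     uniform_limit {r. complex_of_real r \<in> spectrum_op T} (\<lambda>n. poly (q n)) f sequentially \<and>
     (\<lambda>n. op_poly (q n) T) \<longlonglongrightarrow> S)"

definition op_powr :: "('a::chilbert_space \<Rightarrow>\<^sub>L 'a) \<Rightarrow> real \<Rightarrow> ('a \<Rightarrow>\<^sub>L 'a)" where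
  "op_powr T p = op_calc (\<lambda>x. x powr p) T"

definition wgmean ::
  "('a::chilbert_space \<Rightarrow>\<^sub>L 'a) \<Rightarrow> real \<Rightarrow> ('a \<Rightarrow>\<^sub>L 'a) \<Rightarrow> ('a \<Rightarrow>\<^sub>L 'a)"
  ("(_ \<sharp>\<^bsub>_\<^esub> _)" [71, 0, 71] 70) where
  "A \<sharp>\<^bsub>p\<^esub> B =
     op_powr A (1/2) o\<^sub>L
     op_powr (op_powr A (-1/2) o\<^sub>L B o\<^sub>L op_powr A (-1/2)) p o\<^sub>L
     op_powr A (1/2)"

abbreviation gmean ::
  "('a::chilbert_space \<Rightarrow>\<^sub>L 'a) \<Rightarrow> ('a \<Rightarrow>\<^sub>L 'a) \<Rightarrow> ('a \<Rightarrow>\<^sub>L 'a)" (infix "\<sharp>" 70) where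
  "A \<sharp> B \<equiv> A \<sharp>\<^bsub>1/2\<^esub> B"

end

theory Submission
  imports Defs "HOL-Computational_Algebra.Fundamental_Theorem_Algebra"
begin

text \<open>
  The unweighted mean \<open>A \<sharp> B\<close> is the greatest self-adjoint \<open>X\<close> for which the operator matrix with rows
  \<open>(A, X)\<close> and \<open>(X, B)\<close> is positive (\<open>block_nonneg_gmean\<close>, \<open>gmean_greatest\<close>). Positivity of the matrix
  is preserved under sums and under enlarging \<open>A\<close> and \<open>B\<close>, so the mean is monotone and superadditive
  (\<open>gmean_mono\<close>, \<open>gmean_superadditive\<close>). Maximality comes from the Riccati equation \<open>X A\<^bsup>-1\<^esup> X = B\<close>
  solved by \<open>X = A \<sharp> B\<close>, together with a Lyapunov inequality (\<open>positive_if_Lyapunov\<close>). Maximality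
  also makes the positive solution of the Riccati equation unique, whence the midpoint rule
  \<open>(A \<sharp>\<^bsub>p\<^esub> B) \<sharp> (A \<sharp>\<^bsub>q\<^esub> B) = A \<sharp>\<^bsub>(p + q) / 2\<^esub> B\<close>
  (\<open>gmean_wgmean_midpoint\<close>).

  The midpoint rule with \<open>p = s\<close>, \<open>q = 1 - s\<close> and superadditivity give the lower bound. For the other
  two inequalities write \<open>S p\<close> for the sum of the \<open>A j \<sharp>\<^bsub>p\<^esub> B j\<close>. By the midpoint rule,
  superadditivity says that \<open>S ((p + q) / 2)\<close> lies below \<open>S p \<sharp> S q\<close>; bisection,
  monotonicity and continuity extend this to all weights \<open>r\<close> in \<open>[0, 1]\<close>: \<open>S ((1 - r) u + r v)\<close> lies below \<open>S u \<sharp>\<^bsub>r\<^esub> S v\<close>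
  (\<open>sum_wgmean_log_convex\<close>). Using it with \<open>u = t\<close>, \<open>v = 1 - t\<close> for the weights \<open>r\<close> and \<open>1 - r\<close> shows
  that \<open>S s \<sharp> S (1 - s)\<close> lies below \<open>S t \<sharp> S (1 - t)\<close> for \<open>s\<close> between \<open>t\<close> and \<open>1 - t\<close>, and \<open>t = 0\<close> is the
  upper bound by the sums of the \<open>A j\<close> and of the \<open>B j\<close>.

  All this takes from the functional calculus only the laws of the real powers of an invertible
  positive operator and their continuity in the exponent. These rest on one estimate, that the norm of \<open>q(T)\<close> is at most the supremum of
  \<open>|q|\<close> on the real spectrum of a self-adjoint \<open>T\<close> (\<open>norm_op_poly_le\<close>). In turn it depends on the
  invertibility of operators with a coercive form, a consequence of the Banach fixed point theorem.
\<close>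

section \<open>The real inner product and self-adjoint operators\<close>

text \<open>
  The real part of the inner product suffices for every argument below: an operator that commutes
  with the complex scalars is symmetric for \<open>cinner\<close> as soon as it is symmetric for its real part
  (\<open>selfadjoint_op_iff\<close>).
\<close>

definition rinner :: "'a::chilbert_space \<Rightarrow> 'a \<Rightarrow> real" where
  "rinner x y = Re (cinner x y)"

lemma rinner_commute: "rinner x y = rinner y x"
  unfolding rinner_def by (subst cinner_commute) simp

lemma rinner_self: "rinner x x = (norm x)\<^sup>2"
  by (simp add: rinner_def cinner_self)

lemma rinner_add_left: "rinner (x + y) z = rinner x z + rinner y z"
  by (simp add: rinner_def cinner_add_left)

lemma rinner_scaleR_left: "rinner (r *\<^sub>R x) y = r * rinner x y"
  by (simp add: rinner_def scaleR_scaleC cinner_scaleC_left)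

lemma rinner_add_right: "rinner z (x + y) = rinner z x + rinner z y"
  by (metis rinner_add_left rinner_commute)

lemma rinner_scaleR_right: "rinner y (r *\<^sub>R x) = r * rinner y x"
  by (metis rinner_scaleR_left rinner_commute)

text \<open>
  The usual discriminant argument for the form \<open>rinner (T x) y\<close>. Allowing any positive semidefinite \<open>T\<close>
  serves two purposes: the identity gives the Cauchy--Schwarz inequality of the space, and a positive
  operator gives the norm estimate \<open>norm_square_le_of_positive\<close>.
\<close>

lemma semidefinite_Cauchy_Schwarz:
  fixes T :: "'a::chilbert_space \<Rightarrow> 'a"
  assumes lin: "linear T" and sym: "\<And>x y. rinner (T x) y = rinner x (T y)"
    and pos: "\<And>x. 0 \<le> rinner (T x) x"
  shows "(rinner (T x) y)\<^sup>2 \<le> rinner (T x) x * rinner (T y) y"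
proof -
  have expand: "0 \<le> rinner (T x) x + 2 * t * rinner (T x) y + t\<^sup>2 * rinner (T y) y" for t
  proof -
    have "rinner (T (x + t *\<^sub>R y)) (x + t *\<^sub>R y)
      = rinner (T x) x + 2 * t * rinner (T x) y + t\<^sup>2 * rinner (T y) y"
      using sym[of y x]
      by (simp add: linear_add[OF lin] linear_scale[OF lin] rinner_add_left rinner_add_right
          rinner_scaleR_left rinner_scaleR_right rinner_commute[of y "T x"] algebra_simps power2_eq_square)
    then show ?thesis using pos by metis
  qed
  show ?thesis
  proof (cases "rinner (T y) y = 0")
    case True
    have "rinner (T x) y = 0"
    proof (rule ccontr)
      assume "rinner (T x) y \<noteq> 0"
      then show False
        \<comment> \<open>The form is affine in \<open>t\<close>; this \<open>t\<close> makes it equal to \<open>-1\<close>.\<close>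
        using expand[of "- (rinner (T x) x + 1) / (2 * rinner (T x) y)"] True by (simp add: field_simps)
    qed
    then show ?thesis using True by simp
  next
    case False
    then have "rinner (T y) y > 0" using pos[of y] by simp
    then show ?thesis
      \<comment> \<open>The minimum of the quadratic polynomial in \<open>t\<close>.\<close>
      using expand[of "- rinner (T x) y / rinner (T y) y"]
      by (simp add: field_simps power2_eq_square)
  qed
qed

lemma rinner_Cauchy_Schwarz: "\<bar>rinner x y\<bar> \<le> norm x * norm y"
proof -
  have "(rinner x y)\<^sup>2 \<le> (norm x * norm y)\<^sup>2"
    using semidefinite_Cauchy_Schwarz[of "\<lambda>x. x" x y]
    by (simp add: rinner_self power_mult_distrib module_hom_ident)
  then show ?thesis by (simp add: abs_le_square_iff[symmetric])
qed

interpretation rinner: bounded_bilinear "rinner :: 'a::chilbert_space \<Rightarrow> 'a \<Rightarrow> real"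
  by unfold_locales
    (auto simp: rinner_add_left rinner_add_right rinner_scaleR_left rinner_scaleR_right
      intro!: exI[of _ 1] rinner_Cauchy_Schwarz)

lemma selfadjoint_op_iff:
  "selfadjoint_op T \<longleftrightarrow> complex_linear_op T \<and> (\<forall>x y. rinner (T x) y = rinner x (T y))"
proof -
  have right: "cinner x (\<i> *\<^sub>C y) = - \<i> * cinner x y" for x y :: 'a
    by (metis cinner_commute cinner_scaleC_left complex_cnj_cnj complex_cnj_i complex_cnj_mult)
  \<comment> \<open>The imaginary part of \<open>cinner x y\<close> is the real part of \<open>cinner x (\<i> y)\<close>.\<close>
  have split: "cinner x y = Complex (rinner x y) (rinner x (\<i> *\<^sub>C y))" for x y :: 'a
    by (simp add: rinner_def right complex_eq_iff)
  show ?thesis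
  proof
    assume "selfadjoint_op T"
    then show "complex_linear_op T \<and> (\<forall>x y. rinner (T x) y = rinner x (T y))"
      by (simp add: selfadjoint_op_def rinner_def)
  next
    assume *: "complex_linear_op T \<and> (\<forall>x y. rinner (T x) y = rinner x (T y))"
    then have "cinner (T x) y = cinner x (T y)" for x y
      using split[of "T x" y] split[of x "T y"] * unfolding complex_linear_op_def by metis
    then show "selfadjoint_op T" using * by (simp add: selfadjoint_op_def)
  qed
qed

lemma selfadjoint_complex_linear: "selfadjoint_op T \<Longrightarrow> complex_linear_op T"
  by (simp add: selfadjoint_op_def)

lemma selfadjointD: "selfadjoint_op T \<Longrightarrow> rinner (T x) y = rinner x (T y)"
  by (simp add: selfadjoint_op_iff)

lemma positive_op_iff: "positive_op T \<longleftrightarrow> selfadjoint_op T \<and> (\<forall>x. 0 \<le> rinner (T x) x)"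
  by (simp add: positive_op_def rinner_def)

lemma complex_linear_id: "complex_linear_op id_blinfun"
  by (simp add: complex_linear_op_def)

lemma complex_linear_zero: "complex_linear_op 0"
  by (simp add: complex_linear_op_def linear_0[OF bounded_linear.linear[OF bounded_linear_scaleC]])

lemma complex_linear_add:
  "complex_linear_op S \<Longrightarrow> complex_linear_op T \<Longrightarrow> complex_linear_op (S + T)"
  by (simp add: complex_linear_op_def blinfun.add_left scaleC_add_right)

lemma complex_linear_scaleR: "complex_linear_op T \<Longrightarrow> complex_linear_op (r *\<^sub>R T)"
  by (simp add: complex_linear_op_def blinfun.scaleR_left scaleR_scaleC scaleC_scaleC mult.commute)

lemma complex_linear_compose:
  "complex_linear_op S \<Longrightarrow> complex_linear_op T \<Longrightarrow> complex_linear_op (S o\<^sub>L T)"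
  by (simp add: complex_linear_op_def)

lemma selfadjoint_id: "selfadjoint_op id_blinfun"
  by (simp add: selfadjoint_op_iff complex_linear_id)

lemma selfadjoint_zero: "selfadjoint_op 0"
  by (simp add: selfadjoint_op_iff complex_linear_zero rinner.zero_left rinner.zero_right)

lemma selfadjoint_add: "selfadjoint_op S \<Longrightarrow> selfadjoint_op T \<Longrightarrow> selfadjoint_op (S + T)"
  by (simp add: selfadjoint_op_iff complex_linear_add blinfun.add_left rinner.add_left rinner.add_right)

lemma selfadjoint_scaleR: "selfadjoint_op T \<Longrightarrow> selfadjoint_op (r *\<^sub>R T)"
  by (simp add: selfadjoint_op_iff complex_linear_scaleR blinfun.scaleR_left rinner.scaleR_left rinner.scaleR_right)

lemma selfadjoint_diff: "selfadjoint_op S \<Longrightarrow> selfadjoint_op T \<Longrightarrow> selfadjoint_op (S - T)"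
  using selfadjoint_add[of S "(-1) *\<^sub>R T"] selfadjoint_scaleR[of T "-1"] by simp

lemma selfadjoint_sum: "(\<And>i. i \<in> I \<Longrightarrow> selfadjoint_op (f i)) \<Longrightarrow> selfadjoint_op (\<Sum>i\<in>I. f i)"
  by (induction I rule: infinite_finite_induct) (auto intro: selfadjoint_zero selfadjoint_add)

lemma selfadjoint_compose:
  "selfadjoint_op S \<Longrightarrow> selfadjoint_op T \<Longrightarrow> S o\<^sub>L T = T o\<^sub>L S \<Longrightarrow> selfadjoint_op (S o\<^sub>L T)"
  by (metis (no_types, lifting) blinfun_apply_blinfun_compose complex_linear_compose selfadjoint_op_iff)

lemma selfadjoint_sandwich:
  "selfadjoint_op K \<Longrightarrow> selfadjoint_op T \<Longrightarrow> selfadjoint_op (K o\<^sub>L T o\<^sub>L K)"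
  by (simp add: selfadjoint_op_iff complex_linear_compose)

lemma selfadjoint_limit:
  assumes "\<And>n::nat. selfadjoint_op (f n)" and lim: "f \<longlonglongrightarrow> T"
  shows "selfadjoint_op T"
proof -
  have app: "(\<lambda>n. f n x) \<longlonglongrightarrow> T x" for x
    by (intro tendsto_intros lim)
  have "T (c *\<^sub>C x) = c *\<^sub>C T x" for c x
  proof (rule LIMSEQ_unique[OF app])
    show "(\<lambda>n. f n (c *\<^sub>C x)) \<longlonglongrightarrow> c *\<^sub>C T x"
      using bounded_linear.tendsto[OF bounded_linear_scaleC app, of c x] assms(1)
      by (simp add: selfadjoint_op_def complex_linear_op_def)
  qed
  moreover have "rinner (T x) y = rinner x (T y)" for x y
  proof (rule LIMSEQ_unique)
    show "(\<lambda>n. rinner (f n x) y) \<longlonglongrightarrow> rinner (T x) y"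
      by (intro rinner.tendsto app tendsto_const)
    show "(\<lambda>n. rinner (f n x) y) \<longlonglongrightarrow> rinner x (T y)"
      using assms(1) by (simp add: selfadjointD) (intro rinner.tendsto app tendsto_const)
  qed
  ultimately show ?thesis by (simp add: selfadjoint_op_iff complex_linear_op_def)
qed

text \<open>
  Cauchy--Schwarz for the form of \<open>T\<close>, with \<open>T x\<close> as second vector. This turns information on the
  quadratic form into information on norms: a positive operator nearly annihilates each vector on
  which its form nearly vanishes.
\<close>

lemma norm_square_le_of_positive:
  assumes "positive_op T" and le: "\<And>x. rinner (T x) x \<le> c * (norm x)\<^sup>2"
  shows "(norm (T x))\<^sup>2 \<le> c * rinner (T x) x"
proof (cases "T x = 0")
  case True
  then show ?thesis by (simp add: rinner.zero_left)
next
  case False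
  have pos: "0 \<le> rinner (T x) x" for x
    using assms(1) by (simp add: positive_op_iff)
  have "(rinner (T x) (T x))\<^sup>2 \<le> rinner (T x) x * rinner (T (T x)) (T x)"
    using assms(1) by (intro semidefinite_Cauchy_Schwarz)
      (auto simp: positive_op_iff selfadjoint_op_iff intro: bounded_linear.linear blinfun.bounded_linear_right)
  also have "\<dots> \<le> rinner (T x) x * (c * (norm (T x))\<^sup>2)"
    by (intro mult_left_mono le pos)
  finally have "(norm (T x))\<^sup>2 * (norm (T x))\<^sup>2 \<le> (c * rinner (T x) x) * (norm (T x))\<^sup>2"
    by (simp add: rinner_self power2_eq_square mult_ac)
  then show ?thesis using False by (metis mult_right_le_imp_le zero_less_norm_iff zero_less_power)
qed

lemma rinner_le_norm: "rinner ((T :: 'a::chilbert_space \<Rightarrow>\<^sub>L 'a) x) x \<le> norm T * (norm x)\<^sup>2"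
proof -
  have "rinner (T x) x \<le> norm (T x) * norm x" using rinner_Cauchy_Schwarz[of "T x" x] by simp
  also have "\<dots> \<le> (norm T * norm x) * norm x" by (intro mult_right_mono norm_blinfun) simp
  finally show ?thesis by (simp add: power2_eq_square)
qed

section \<open>Invertible operators and coercive forms\<close>

lemma blinfun_compose_assoc: "(R o\<^sub>L S) o\<^sub>L T = R o\<^sub>L (S o\<^sub>L T)"
  by (rule blinfun_eqI) simp

lemma blinfun_compose_id: "T o\<^sub>L id_blinfun = T" "id_blinfun o\<^sub>L T = T"
  by (rule blinfun_eqI; simp)+

lemma invertible_opI:
  assumes cl: "complex_linear_op T" and left: "S o\<^sub>L T = id_blinfun" and right: "T o\<^sub>L R = id_blinfun"
  shows "invertible_op T"
proof -
  have SR: "S = R"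
    by (metis blinfun_compose_assoc blinfun_compose_id left right)
  have ST: "S (T x) = x" "T (S x) = x" for x
    using left right SR by (metis blinfun_apply_blinfun_compose id_blinfun.rep_eq)+
  have "S (c *\<^sub>C x) = c *\<^sub>C S x" for c x
    using cl ST unfolding complex_linear_op_def by metis
  then show ?thesis
    unfolding invertible_op_def complex_linear_op_def using left right SR by blast
qed

lemma invertible_opE:
  assumes "invertible_op T"
  obtains S where "complex_linear_op S" "S o\<^sub>L T = id_blinfun" "T o\<^sub>L S = id_blinfun"
  using assms unfolding invertible_op_def by blast

lemma invertible_op_compose:
  assumes "invertible_op S" "invertible_op T" "complex_linear_op S" "complex_linear_op T"
  shows "invertible_op (S o\<^sub>L T)"
proof -
  obtain S' where S': "S' o\<^sub>L S = id_blinfun" "S o\<^sub>L S' = id_blinfun"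
    using assms(1) by (rule invertible_opE)
  obtain T' where T': "T' o\<^sub>L T = id_blinfun" "T o\<^sub>L T' = id_blinfun"
    using assms(2) by (rule invertible_opE)
  show ?thesis
  proof (rule invertible_opI[OF complex_linear_compose[OF assms(3,4)]])
    show "(T' o\<^sub>L S') o\<^sub>L (S o\<^sub>L T) = id_blinfun"
      by (metis S'(1) T'(1) blinfun_compose_assoc blinfun_compose_id)
    show "(S o\<^sub>L T) o\<^sub>L (T' o\<^sub>L S') = id_blinfun"
      by (metis S'(2) T'(2) blinfun_compose_assoc blinfun_compose_id)
  qed
qed

interpretation blinfun_compose: bounded_bilinear "(o\<^sub>L)"
  by (rule bounded_bilinear_blinfun_compose)

lemma invertible_op_scaleR:
  assumes "invertible_op T" "complex_linear_op T" "r \<noteq> 0"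
  shows "invertible_op (r *\<^sub>R T)"
proof -
  obtain S where S: "S o\<^sub>L T = id_blinfun" "T o\<^sub>L S = id_blinfun"
    using assms(1) by (rule invertible_opE)
  show ?thesis
    by (rule invertible_opI[OF complex_linear_scaleR[OF assms(2)],
          of "inverse r *\<^sub>R S" _ "inverse r *\<^sub>R S"])
      (use S assms(3) in \<open>simp_all add: blinfun_compose.scaleR_left blinfun_compose.scaleR_right\<close>)
qed

text \<open>
  For \<open>M\<close> at least \<open>d\<close> and \<open>norm T\<close>, the operator \<open>U = 1 - T / M\<close> is positive and its form on unit
  vectors is at most \<open>k = 1 - d / M < 1\<close>. Hence \<open>U\<close> is a strict contraction, and the Banach fixed point
  theorem solves \<open>T x = y\<close> in the form \<open>x = U x + y / M\<close>.
\<close>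

lemma coercive_op_invertible:
  assumes sa: "selfadjoint_op T" and d: "d > 0" and coer: "\<And>x. d * (norm x)\<^sup>2 \<le> rinner (T x) x"
  shows "invertible_op T"
proof -
  define M where "M = norm T + d"
  have M: "M > 0" "M \<ge> d" "M \<ge> norm T"
    using d by (auto simp: M_def add_nonneg_pos)
  define U where "U = id_blinfun - inverse M *\<^sub>R T"
  define k where "k = 1 - d / M"
  have k: "0 \<le> k" "k < 1" using M d by (auto simp: k_def)
  have Uform: "rinner (U x) x = (norm x)\<^sup>2 - rinner (T x) x / M" for x
    by (simp add: U_def blinfun.diff_left blinfun.scaleR_left rinner.diff_left rinner.scaleR_left
        rinner_self field_simps)
  have "positive_op U"
    unfolding positive_op_iff
  proof (intro conjI allI)
    show "selfadjoint_op U"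
      unfolding U_def by (intro selfadjoint_diff selfadjoint_id selfadjoint_scaleR sa)
    show "0 \<le> rinner (U x) x" for x
    proof -
      have "rinner (T x) x \<le> M * (norm x)\<^sup>2"
        using rinner_le_norm[of T x] M(3) mult_right_mono[of "norm T" M "(norm x)\<^sup>2"] by simp
      then show ?thesis using M by (simp add: Uform field_simps)
    qed
  qed
  moreover have Ule: "rinner (U x) x \<le> k * (norm x)\<^sup>2" for x
    using coer[of x] M by (simp add: Uform k_def field_simps)
  ultimately have "(norm (U x))\<^sup>2 \<le> k * rinner (U x) x" for x
    by (rule norm_square_le_of_positive)
  then have "(norm (U x))\<^sup>2 \<le> (k * norm x)\<^sup>2" for x
    using mult_left_mono[OF Ule k(1), of x] order_trans by (fastforce simp: power2_eq_square mult_ac)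
  then have U: "norm (U x) \<le> k * norm x" for x
    using k(1) by (meson mult_nonneg_nonneg norm_ge_zero power2_le_imp_le)
  have surj: "\<exists>x. T x = y" for y
  proof -
    have "\<exists>!x. U x + inverse M *\<^sub>R y = x"
      by (rule banach_fix_type[OF k]) (simp add: dist_norm U flip: blinfun.diff_right)
    then obtain x where "U x + inverse M *\<^sub>R y = x" by blast
    then have "T x = y"
      using M(1) by (auto simp: U_def blinfun.diff_left blinfun.scaleR_left algebra_simps)
    then show ?thesis ..
  qed
  have below: "d * norm x \<le> norm (T x)" for x
  proof (cases "x = 0")
    case False
    have "d * (norm x)\<^sup>2 \<le> norm (T x) * norm x"
      using coer[of x] rinner_Cauchy_Schwarz[of "T x" x] by linarith
    then show ?thesis using False by (simp add: power2_eq_square)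
  qed simp
  have inj: "x = y" if "T x = T y" for x y
    using below[of "x - y"] that d by (simp add: blinfun.diff_right mult_le_0_iff)
  \<comment> \<open>The inverse is linear because \<open>T\<close> is injective, and bounded because \<open>T\<close> is bounded below.\<close>
  define g where "g y = (SOME x. T x = y)" for y
  have Tg: "T (g y) = y" for y unfolding g_def by (rule someI_ex[OF surj])
  have "bounded_linear g"
  proof (rule bounded_linear_intro)
    show "g (x + y) = g x + g y" for x y by (rule inj) (simp add: Tg blinfun.add_right)
    show "g (r *\<^sub>R x) = r *\<^sub>R g x" for r x by (rule inj) (simp add: Tg blinfun.scaleR_right)
    show "norm (g x) \<le> norm x * inverse d" for x
      using below[of "g x"] d by (simp add: Tg field_simps)
  qed
  then have app: "blinfun_apply (Blinfun g) = g" by (rule bounded_linear_Blinfun_apply)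
  have "Blinfun g o\<^sub>L T = id_blinfun" by (rule blinfun_eqI) (simp add: app inj Tg)
  moreover have "T o\<^sub>L Blinfun g = id_blinfun" by (rule blinfun_eqI) (simp add: app Tg)
  ultimately show ?thesis
    using selfadjoint_complex_linear[OF sa] invertible_opI by blast
qed

text \<open>
  If \<open>S\<close> inverts the positive operator \<open>T\<close>, then \<open>norm x\<close> is controlled by \<open>norm (T x)\<close>, and the
  square of the latter by the form of \<open>T\<close> at \<open>x\<close>. Coercivity makes it visible that sums of invertible positive operators are invertible.
\<close>

lemma invertible_positive_iff_coercive:
  "T \<in> invertible_positive_ops \<longleftrightarrow>
    selfadjoint_op T \<and> (\<exists>d>0. \<forall>x. d * (norm x)\<^sup>2 \<le> rinner (T x) x)"
proof
  assume "T \<in> invertible_positive_ops"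
  then have pos: "positive_op T" and inv: "invertible_op T"
    by (auto simp: invertible_positive_ops_def)
  obtain S where S: "S o\<^sub>L T = id_blinfun" using inv by (rule invertible_opE)
  define M where "M = norm T + 1"
  define N where "N = norm S + 1"
  have MN: "M > 0" "N > 0" by (auto simp: M_def N_def add_nonneg_pos)
  have "inverse (N\<^sup>2 * M) * (norm x)\<^sup>2 \<le> rinner (T x) x" for x
  proof -
    have le: "rinner (T x) x \<le> M * (norm x)\<^sup>2" for x
      using rinner_le_norm[of T x] mult_right_mono[of "norm T" M "(norm x)\<^sup>2"] by (simp add: M_def)
    have "x = S (T x)" using S by (metis blinfun_apply_blinfun_compose id_blinfun.rep_eq)
    then have "norm x \<le> norm S * norm (T x)" using norm_blinfun by metis
    also have "\<dots> \<le> N * norm (T x)" by (intro mult_right_mono) (auto simp: N_def)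
    finally have "(norm x)\<^sup>2 \<le> (N * norm (T x))\<^sup>2" by (simp add: power_mono)
    also have "\<dots> \<le> N\<^sup>2 * (M * rinner (T x) x)"
      unfolding power_mult_distrib
      by (intro mult_left_mono norm_square_le_of_positive[OF pos le]) simp
    finally show ?thesis using MN by (simp add: field_simps)
  qed
  moreover have "inverse (N\<^sup>2 * M) > 0" using MN by simp
  ultimately show "selfadjoint_op T \<and> (\<exists>d>0. \<forall>x. d * (norm x)\<^sup>2 \<le> rinner (T x) x)"
    using pos by (auto simp: positive_op_iff)
next
  assume *: "selfadjoint_op T \<and> (\<exists>d>0. \<forall>x. d * (norm x)\<^sup>2 \<le> rinner (T x) x)"
  then obtain d where d: "d > 0" "\<And>x. d * (norm x)\<^sup>2 \<le> rinner (T x) x" by blast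
  have "0 \<le> rinner (T x) x" for x
    using d(1) d(2)[of x] by (smt (verit) mult_nonneg_nonneg zero_le_power2)
  then show "T \<in> invertible_positive_ops"
    using coercive_op_invertible[OF _ d] * by (auto simp: invertible_positive_ops_def positive_op_iff)
qed

section \<open>Real polynomials in an operator\<close>

lemma op_poly_eq_sum:
  assumes "degree q \<le> n"
  shows "op_poly q T = (\<Sum>i\<le>n. coeff q i *\<^sub>R (((o\<^sub>L) T) ^^ i) id_blinfun)"
  unfolding op_poly_def
  by (rule sum.mono_neutral_left) (use assms in \<open>auto simp: coeff_eq_0\<close>)

lemma op_poly_0: "op_poly 0 T = 0"
  by (simp add: op_poly_def)

lemma op_poly_pCons: "op_poly (pCons a q) T = a *\<^sub>R id_blinfun + (T o\<^sub>L op_poly q T)"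
proof -
  have "op_poly (pCons a q) T
      = (\<Sum>i\<le>Suc (degree q). coeff (pCons a q) i *\<^sub>R (((o\<^sub>L) T) ^^ i) id_blinfun)"
    by (rule op_poly_eq_sum) (simp add: degree_pCons_le)
  also have "\<dots> = a *\<^sub>R id_blinfun + (T o\<^sub>L op_poly q T)"
    by (simp add: sum.atMost_Suc_shift op_poly_def blinfun_compose.sum_right
        blinfun_compose.scaleR_right del: sum.atMost_Suc)
  finally show ?thesis .
qed

lemma op_poly_const: "op_poly [:a:] T = a *\<^sub>R id_blinfun"
  by (simp add: op_poly_pCons op_poly_0)

lemma op_poly_X: "op_poly [:0, 1:] T = T"
  by (simp add: op_poly_pCons op_poly_0 blinfun_compose_id)

lemma op_poly_add: "op_poly (p + q) T = op_poly p T + op_poly q T"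
proof -
  define n where "n = max (degree p) (degree q)"
  have "degree p \<le> n" "degree q \<le> n" "degree (p + q) \<le> n"
    by (auto simp: n_def degree_add_le_max)
  then show ?thesis
    by (simp add: op_poly_eq_sum[of _ n] scaleR_add_left sum.distrib)
qed

lemma op_poly_smult: "op_poly (smult c p) T = c *\<^sub>R op_poly p T"
  using op_poly_eq_sum[of "smult c p" "degree p" T]
  by (simp add: op_poly_def scaleR_sum_right degree_smult_le)

lemma op_poly_diff: "op_poly (p - q) T = op_poly p T - op_poly q T"
  using op_poly_add[of p "smult (-1) q" T] op_poly_smult[of "-1" q T] by simp

lemma op_poly_mult: "op_poly (p * q) T = op_poly p T o\<^sub>L op_poly q T"
  by (induction p)
    (simp_all add: op_poly_0 op_poly_pCons op_poly_add op_poly_smult blinfun_compose.add_left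
      blinfun_compose.scaleR_left blinfun_compose_id blinfun_compose_assoc)

lemma selfadjoint_op_poly:
  assumes "selfadjoint_op T"
  shows "selfadjoint_op (op_poly p T)"
proof (induction p)
  case (pCons a p)
  have "T o\<^sub>L op_poly p T = op_poly p T o\<^sub>L T"
    using op_poly_mult[of "[:0, 1:]" p T] op_poly_mult[of p "[:0, 1:]" T]
    by (simp only: op_poly_X mult.commute)
  then show ?case
    unfolding op_poly_pCons
    by (intro selfadjoint_add selfadjoint_scaleR selfadjoint_id selfadjoint_compose assms pCons.IH)
qed (simp add: op_poly_0 selfadjoint_zero)

section \<open>Spectral mapping and the norm of a polynomial in an operator\<close>

definition real_spectrum :: "('a::chilbert_space \<Rightarrow>\<^sub>L 'a) \<Rightarrow> real set" where
  "real_spectrum T = {r. complex_of_real r \<in> spectrum_op T}"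

lemma real_spectrum_iff:
  fixes T :: "'a::chilbert_space \<Rightarrow>\<^sub>L 'a"
  shows "r \<in> real_spectrum T \<longleftrightarrow> \<not> invertible_op (T - r *\<^sub>R id_blinfun)"
proof -
  have "scalar_op (complex_of_real r) = r *\<^sub>R (id_blinfun :: 'a \<Rightarrow>\<^sub>L 'a)"
    by (rule blinfun_eqI) (simp add: scalar_op.rep_eq scaleR_scaleC blinfun.scaleR_left)
  then show ?thesis by (simp add: real_spectrum_def spectrum_op_def)
qed

text \<open>
  Take a complex root \<open>a + b \<i>\<close>. A real one splits off a linear factor. A proper complex one is also
  a root of the real quadratic \<open>(X - a)\<^sup>2 + b\<^sup>2\<close>, and the remainder of the division by it is a
  real polynomial of degree at most one with a non-real root, hence zero.
\<close>

lemma real_poly_factor: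
  fixes p :: "real poly"
  assumes "degree p > 0"
  shows "(\<exists>r. [:-r, 1:] dvd p) \<or> (\<exists>a b. b \<noteq> 0 \<and> [:a\<^sup>2 + b\<^sup>2, -2 * a, 1:] dvd p)"
proof -
  define ev where "ev p z = poly (map_poly complex_of_real p) z" for p z
  have pCons: "ev (pCons a p) z = of_real a + z * ev p z" for a p z
    by (simp add: ev_def map_poly_pCons)
  have zero: "ev 0 z = 0" for z by (simp add: ev_def)
  have "map_poly complex_of_real (p + q) = map_poly of_real p + map_poly of_real q" for p q
    by (rule poly_eqI) (simp add: coeff_map_poly)
  then have add: "ev (p + q) z = ev p z + ev q z" for p q z by (simp add: ev_def)
  have smult: "ev (smult c p) z = of_real c * ev p z" for c p z
    by (simp add: ev_def map_poly_smult)
  have mult: "ev (p * q) z = ev p z * ev q z" for p q z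
    by (induction p) (simp_all add: pCons add smult zero algebra_simps)
  have "\<not> constant (poly (map_poly complex_of_real p))"
    using assms by (simp add: constant_degree degree_map_poly)
  then obtain z where z: "ev p z = 0"
    using fundamental_theorem_of_algebra unfolding ev_def by blast
  define a b where "a = Re z" and "b = Im z"
  have zab: "z = Complex a b" by (simp add: a_def b_def)
  show ?thesis
  proof (cases "b = 0")
    case True
    then have za: "z = of_real a" by (simp add: zab complex_eq_iff)
    have "ev p (of_real a) = of_real (poly p a)"
      by (induction p) (simp_all add: pCons zero)
    then have "[:-a, 1:] dvd p" using z za by (simp add: poly_eq_0_iff_dvd)
    then show ?thesis by blast
  next
    case False
    define Q where "Q = [:a\<^sup>2 + b\<^sup>2, -2 * a, 1:]"
    have Qz: "ev Q z = 0"
      by (simp add: Q_def pCons zero zab complex_eq_iff power2_eq_square algebra_simps)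
    define r where "r = p mod Q"
    have p: "p = Q * (p div Q) + r" by (simp add: r_def)
    have "degree r < 2"
      using degree_mod_less[of Q p] by (auto simp: r_def Q_def)
    then have "r = [:coeff r 0, coeff r 1:]"
      by (intro poly_eqI) (auto simp: coeff_pCons coeff_eq_0 split: nat.splits)
    then obtain u v where r: "r = [:u, v:]" by blast
    have "ev r z = 0" using z p Qz by (metis add mult add_0 mult_zero_left)
    then have "v = 0 \<and> u = 0" using False by (auto simp: r pCons zero zab complex_eq_iff)
    then have "Q dvd p" using r by (simp add: r_def mod_eq_0_iff_dvd)
    then show ?thesis using False unfolding Q_def by blast
  qed
qed

text \<open>
  The half of the spectral mapping theorem that the functional calculus rests on, by splitting off
  real factors one at a time. A linear factor \<open>X - r\<close> gives the invertible \<open>T - r\<close>, because \<open>r\<close> is not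
  in the spectrum; a quadratic factor \<open>(X - a)\<^sup>2 + b\<^sup>2\<close> gives a coercive operator, because \<open>T - a\<close>
  has a positive square and \<open>b\<^sup>2 > 0\<close>.
\<close>

lemma op_poly_invertible:
  fixes T :: "'a::chilbert_space \<Rightarrow>\<^sub>L 'a"
  assumes T: "selfadjoint_op T" and "p \<noteq> 0" and "\<And>x. x \<in> real_spectrum T \<Longrightarrow> poly p x \<noteq> 0"
  shows "invertible_op (op_poly p T)"
  using assms(2,3)
proof (induction "degree p" arbitrary: p rule: less_induct)
  case less
  note cl = selfadjoint_complex_linear[OF selfadjoint_op_poly[OF T]]
  have id: "invertible_op (id_blinfun :: 'a \<Rightarrow>\<^sub>L 'a)"
    by (rule invertible_opI[OF complex_linear_id blinfun_compose_id(1) blinfun_compose_id(1)])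
  have step: ?case if dvd: "Q dvd p" and deg: "degree Q > 0" and inv: "invertible_op (op_poly Q T)" for Q
  proof -
    obtain p' where p': "p = Q * p'" using dvd by blast
    have "Q \<noteq> 0" "p' \<noteq> 0" using less.prems(1) p' by auto
    then have "degree p' < degree p" using p' deg by (simp add: degree_mult_eq)
    then have "invertible_op (op_poly p' T)"
      using less.hyps \<open>p' \<noteq> 0\<close> less.prems(2) p' by simp
    then show ?case
      unfolding p' op_poly_mult by (intro invertible_op_compose inv cl)
  qed
  consider "degree p = 0" | r where "[:-r, 1:] dvd p"
    | a b where "b \<noteq> 0" "[:a\<^sup>2 + b\<^sup>2, -2 * a, 1:] dvd p"
    using real_poly_factor[of p] by blast
  then show ?case
  proof cases
    case 1
    then obtain c where "p = [:c:]" by (rule degree_eq_zeroE)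
    then show ?thesis
      using less.prems(1) id by (simp add: op_poly_const invertible_op_scaleR complex_linear_id)
  next
    case (2 r)
    then have "poly p r = 0" by (simp add: poly_eq_0_iff_dvd)
    then have "r \<notin> real_spectrum T" using less.prems(2) by blast
    then have "invertible_op (op_poly [:-r, 1:] T)"
      by (simp add: real_spectrum_iff op_poly_pCons op_poly_0 blinfun_compose_id)
    then show ?thesis using step[OF 2] by simp
  next
    case (3 a b)
    define U where "U = T - a *\<^sub>R id_blinfun"
    have U: "selfadjoint_op U"
      unfolding U_def by (intro selfadjoint_diff selfadjoint_scaleR selfadjoint_id T)
    have eq: "op_poly [:a\<^sup>2 + b\<^sup>2, -2 * a, 1:] T = (U o\<^sub>L U) + b\<^sup>2 *\<^sub>R id_blinfun"
      by (rule blinfun_eqI) (simp add: op_poly_pCons op_poly_0 blinfun_compose_id U_def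
          blinfun.add_left blinfun.diff_left blinfun.scaleR_left blinfun.add_right
          blinfun.diff_right blinfun.scaleR_right algebra_simps power2_eq_square scaleR_2
          flip: scaleR_scaleR)
    have "invertible_op (op_poly [:a\<^sup>2 + b\<^sup>2, -2 * a, 1:] T)"
    proof (rule coercive_op_invertible[OF selfadjoint_op_poly[OF T], of "b\<^sup>2"])
      show "b\<^sup>2 > 0" using 3 by simp
      have "rinner (U (U x)) x = (norm (U x))\<^sup>2" for x
        using selfadjointD[OF U, of "U x" x] by (simp add: rinner_self)
      then show "b\<^sup>2 * (norm x)\<^sup>2 \<le> rinner (op_poly [:a\<^sup>2 + b\<^sup>2, -2 * a, 1:] T x) x" for x
        unfolding eq
        by (simp add: blinfun.add_left blinfun.scaleR_left rinner.add_left rinner.scaleR_left rinner_self)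
    qed
    then show ?thesis using step[OF 3(2)] by simp
  qed
qed

text \<open>
  With \<open>c = norm R\<close>, the form of \<open>V = c\<^sup>2 - R\<^sup>2\<close> at \<open>x\<close> is \<open>c\<^sup>2 (norm x)\<^sup>2 - (norm (R x))\<^sup>2\<close>. It
  comes arbitrarily close to zero on the unit sphere, so by \<open>norm_square_le_of_positive\<close> the positive
  operator \<open>V\<close> is not bounded below. Quantitatively, an inverse of \<open>V\<close> would give the strictly
  smaller bound \<open>sqrt k\<close> for the norm of \<open>R\<close>. This expresses that \<open>c\<close> or \<open>- c\<close> is a spectral
  value, without having to decide which.
\<close>

lemma norm_square_minus_square_not_invertible:
  assumes R: "selfadjoint_op R" and c: "norm R > 0"
  shows "\<not> invertible_op ((norm R)\<^sup>2 *\<^sub>R id_blinfun - (R o\<^sub>L R))"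
proof
  define c where "c = norm R"
  have c0: "c > 0" using c by (simp add: c_def)
  define V where "V = c\<^sup>2 *\<^sub>R id_blinfun - (R o\<^sub>L R)"
  assume "invertible_op ((norm R)\<^sup>2 *\<^sub>R id_blinfun - (R o\<^sub>L R))"
  then obtain S where S: "S o\<^sub>L V = id_blinfun"
    unfolding V_def c_def by (rule invertible_opE)
  define N where "N = norm S + 1"
  have N: "N > 0" by (simp add: N_def add_nonneg_pos)
  have Vform: "rinner (V x) x = c\<^sup>2 * (norm x)\<^sup>2 - (norm (R x))\<^sup>2" for x
    using selfadjointD[OF R, of "R x" x]
    by (simp add: V_def blinfun.diff_left blinfun.scaleR_left rinner.diff_left rinner.scaleR_left
        rinner_self)
  have "(norm (R x))\<^sup>2 \<le> (c * norm x)\<^sup>2" for x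
    unfolding c_def by (intro power_mono norm_blinfun) simp
  then have "positive_op V"
    unfolding positive_op_iff Vform unfolding V_def
    by (auto simp: power_mult_distrib intro!: selfadjoint_diff selfadjoint_scaleR selfadjoint_id selfadjoint_compose R)
  then have sq: "(norm (V x))\<^sup>2 \<le> c\<^sup>2 * rinner (V x) x" for x
    by (rule norm_square_le_of_positive) (simp add: Vform)
  define k where "k = max 0 (c\<^sup>2 - inverse (N\<^sup>2 * c\<^sup>2))"
  have "norm R \<le> sqrt k"
  proof (rule norm_blinfun_bound)
    show "norm (R x) \<le> sqrt k * norm x" for x
    proof -
      have "x = S (V x)" using S by (metis blinfun_apply_blinfun_compose id_blinfun.rep_eq)
      then have "norm x \<le> norm S * norm (V x)" using norm_blinfun by metis
      also have "\<dots> \<le> N * norm (V x)" by (intro mult_right_mono) (auto simp: N_def)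
      finally have "(norm x)\<^sup>2 \<le> (N * norm (V x))\<^sup>2" by (simp add: power_mono)
      also have "\<dots> \<le> N\<^sup>2 * (c\<^sup>2 * rinner (V x) x)"
        unfolding power_mult_distrib by (intro mult_left_mono sq) simp
      finally have "(norm (R x))\<^sup>2 \<le> (c\<^sup>2 - inverse (N\<^sup>2 * c\<^sup>2)) * (norm x)\<^sup>2"
        unfolding Vform using N c0 by (simp add: field_simps)
      also have "\<dots> \<le> k * (norm x)\<^sup>2" by (intro mult_right_mono) (auto simp: k_def)
      finally have "(norm (R x))\<^sup>2 \<le> (sqrt k * norm x)\<^sup>2"
        by (simp add: power_mult_distrib k_def)
      then show ?thesis by (rule power2_le_imp_le) (simp add: k_def)
    qed
  qed (simp add: k_def)
  then have "c\<^sup>2 \<le> k"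
    using c0 power_mono[of c "sqrt k" 2] by (simp add: c_def k_def)
  moreover have "inverse (N\<^sup>2 * c\<^sup>2) > 0" using N c0 by simp
  moreover have "c\<^sup>2 > 0" using c0 by simp
  ultimately show False by (simp add: k_def max_def split: if_splits)
qed

text \<open>
  The polynomial \<open>(norm T)\<^sup>2 - X\<^sup>2\<close> yields an operator without inverse, so it vanishes
  somewhere on the spectrum. This needs \<open>T \<noteq> 0\<close>; the zero operator has the spectral value \<open>0\<close>, except on
  the zero space, where it is invertible.
\<close>

lemma real_spectrum_nonempty:
  fixes T :: "'a::chilbert_space \<Rightarrow>\<^sub>L 'a"
  assumes T: "selfadjoint_op T" and nontrivial: "(id_blinfun :: 'a \<Rightarrow>\<^sub>L 'a) \<noteq> 0"
  shows "real_spectrum T \<noteq> {}"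
proof (cases "T = 0")
  case True
  have "\<not> invertible_op (0 :: 'a \<Rightarrow>\<^sub>L 'a)"
    using nontrivial by (auto simp: invertible_op_def)
  then have "0 \<in> real_spectrum T" by (simp add: real_spectrum_iff True)
  then show ?thesis by blast
next
  case False
  have "op_poly [:(norm T)\<^sup>2, 0, -1:] T = (norm T)\<^sup>2 *\<^sub>R id_blinfun - (T o\<^sub>L T)"
    by (simp add: op_poly_pCons op_poly_0 blinfun_compose_id blinfun_compose.minus_right
        blinfun_compose.scaleR_right)
  then show ?thesis
    using norm_square_minus_square_not_invertible[OF T] op_poly_invertible[OF T, of "[:(norm T)\<^sup>2, 0, -1:]"] False by auto
qed

text \<open>
  If \<open>c = norm (op_poly q T)\<close> exceeded \<open>e\<close>, then \<open>c\<^sup>2 - q\<^sup>2\<close> would be positive on the spectrum, so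
  \<open>c\<^sup>2 - (op_poly q T)\<^sup>2\<close> would be invertible, which the preceding lemmas forbid.
\<close>

lemma norm_op_poly_le:
  fixes T :: "'a::chilbert_space \<Rightarrow>\<^sub>L 'a"
  assumes T: "selfadjoint_op T" and e: "0 \<le> e" and le: "\<And>x. x \<in> real_spectrum T \<Longrightarrow> \<bar>poly q x\<bar> \<le> e"
  shows "norm (op_poly q T) \<le> e"
proof (rule ccontr)
  define c where "c = norm (op_poly q T)"
  assume "\<not> norm (op_poly q T) \<le> e"
  then have c: "c > e" "c > 0" using e by (auto simp: c_def)
  define p where "p = [:c\<^sup>2:] - q * q"
  have pos: "poly p x > 0" if "x \<in> real_spectrum T" for x
  proof -
    have "\<bar>poly q x\<bar> < \<bar>c\<bar>" using le[OF that] c by simp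
    then have "(poly q x)\<^sup>2 < c\<^sup>2" by (metis abs_ge_zero power2_abs power_strict_mono zero_less_numeral)
    then show ?thesis by (simp add: p_def power2_eq_square)
  qed
  have "(id_blinfun :: 'a \<Rightarrow>\<^sub>L 'a) \<noteq> 0"
  proof
    assume "(id_blinfun :: 'a \<Rightarrow>\<^sub>L 'a) = 0"
    then have "op_poly q T = 0" by (metis blinfun_compose_id(1) blinfun_compose.zero_right)
    then show False using c by (simp add: c_def)
  qed
  \<comment> \<open>On an empty spectrum \<open>p\<close> could vanish identically, with \<open>q\<close> constantly \<open>c\<close> or \<open>- c\<close>.\<close>
  then obtain x where "x \<in> real_spectrum T" using real_spectrum_nonempty[OF T] by blast
  then have "p \<noteq> 0" using pos by force
  then have "invertible_op (op_poly p T)"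
    using op_poly_invertible[OF T] pos by (metis less_irrefl)
  then show False
    using norm_square_minus_square_not_invertible[OF selfadjoint_op_poly[OF T], of q] c(2)
    by (simp add: p_def op_poly_diff op_poly_const op_poly_mult c_def)
qed

section \<open>The continuous functional calculus\<close>

text \<open>
  Two polynomial sequences with the same uniform limit on the spectrum differ by polynomials that
  tend to zero there, and \<open>norm_op_poly_le\<close> transfers this to the operators. Hence the limit
  described in \<open>op_calc\<close> is unique.
\<close>

lemma op_calc_eqI:
  assumes T: "selfadjoint_op T"
    and f: "uniform_limit (real_spectrum T) (\<lambda>n. poly (q n)) f sequentially"
    and S: "(\<lambda>n. op_poly (q n) T) \<longlonglongrightarrow> S"
  shows "op_calc f T = S"
  unfolding op_calc_def real_spectrum_def[symmetric]
proof (rule the_equality)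
  show "\<exists>q. uniform_limit (real_spectrum T) (\<lambda>n. poly (q n)) f sequentially \<and>
      (\<lambda>n. op_poly (q n) T) \<longlonglongrightarrow> S"
    using f S by blast
next
  fix S'
  assume "\<exists>q. uniform_limit (real_spectrum T) (\<lambda>n. poly (q n)) f sequentially \<and>
      (\<lambda>n. op_poly (q n) T) \<longlonglongrightarrow> S'"
  then obtain r where r: "uniform_limit (real_spectrum T) (\<lambda>n. poly (r n)) f sequentially"
    "(\<lambda>n. op_poly (r n) T) \<longlonglongrightarrow> S'" by blast
  have diff: "uniform_limit (real_spectrum T) (\<lambda>n x. poly (r n) x - poly (q n) x)
      (\<lambda>x. f x - f x) sequentially"
    by (intro uniform_limit_minus r f)
  have "(\<lambda>n. op_poly (r n - q n) T) \<longlonglongrightarrow> 0"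
  proof (rule LIMSEQ_I)
    fix e :: real assume e: "e > 0"
    have "\<forall>\<^sub>F n in sequentially. \<forall>x\<in>real_spectrum T. \<bar>poly (r n - q n) x\<bar> < e / 2"
      using uniform_limitD[OF diff, of "e / 2"] e by (simp add: dist_real_def)
    then have "\<forall>\<^sub>F n in sequentially. norm (op_poly (r n - q n) T - 0) < e"
    proof eventually_elim
      case (elim n)
      then have "norm (op_poly (r n - q n) T) \<le> e / 2"
        using e by (intro norm_op_poly_le T) (auto intro: less_imp_le)
      then show ?case using e by simp
    qed
    then show "\<exists>no. \<forall>n\<ge>no. norm (op_poly (r n - q n) T - 0) < e"
      by (simp add: eventually_sequentially)
  qed
  moreover have "(\<lambda>n. op_poly (r n - q n) T) \<longlonglongrightarrow> S' - S"
    unfolding op_poly_diff by (intro tendsto_diff r S)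
  ultimately show "S' = S" using LIMSEQ_unique by fastforce
qed

text \<open>
  Existence of the limit: Weierstrass approximation on a compact set containing the spectrum, and
  completeness of the space of operators. The approximation is uniform on all of \<open>C\<close>, on which
  continuous functions are bounded; this is what products need.
\<close>

lemma op_calc_approx:
  assumes T: "selfadjoint_op T" and C: "compact C" "real_spectrum T \<subseteq> C" and f: "continuous_on C f"
  obtains q where "uniform_limit C (\<lambda>n. poly (q n)) f sequentially"
    "(\<lambda>n. op_poly (q n) T) \<longlonglongrightarrow> op_calc f T"
proof -
  have "\<exists>q. \<forall>x\<in>C. \<bar>f x - poly q x\<bar> < inverse (Suc n)" for n
  proof -
    obtain g where g: "real_polynomial_function g" "\<And>x. x \<in> C \<Longrightarrow> \<bar>f x - g x\<bar> < inverse (Suc n)"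
      using Stone_Weierstrass_real_polynomial_function[OF C(1) f, of "inverse (Suc n)"]
      by (auto simp del: of_nat_Suc)
    obtain a k where "g = (\<lambda>x. \<Sum>i\<le>k. a i * x ^ i)"
      using g(1) unfolding real_polynomial_function_iff_sum by blast
    then have "g = poly (\<Sum>i\<le>k. monom (a i) i)"
      by (simp add: poly_sum poly_monom fun_eq_iff)
    then show ?thesis using g(2) by blast
  qed
  then obtain q where q: "\<And>n x. x \<in> C \<Longrightarrow> \<bar>f x - poly (q n) x\<bar> < inverse (Suc n)" by metis
  have unif: "uniform_limit C (\<lambda>n. poly (q n)) f sequentially"
  proof (rule uniform_limitI)
    fix e :: real assume "e > 0"
    then have "\<forall>\<^sub>F n in sequentially. inverse (real (Suc n)) < e"
      using LIMSEQ_inverse_real_of_nat order_tendstoD(2) by blast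
    then show "\<forall>\<^sub>F n in sequentially. \<forall>x\<in>C. dist (poly (q n) x) (f x) < e"
    proof eventually_elim
      case (elim n)
      then show ?case
        using q[of _ n] by (metis abs_minus_commute dist_real_def less_trans)
    qed
  qed
  have "Cauchy (\<lambda>n. op_poly (q n) T)"
  proof (rule metric_CauchyI)
    fix e :: real assume e: "e > 0"
    then obtain N where N: "\<And>n x. n \<ge> N \<Longrightarrow> x \<in> C \<Longrightarrow> \<bar>poly (q n) x - f x\<bar> < e / 4"
      using unif unfolding uniform_limit_sequentially_iff dist_real_def
      by (metis zero_less_divide_iff zero_less_numeral)
    have "dist (op_poly (q m) T) (op_poly (q n) T) < e" if "m \<ge> N" "n \<ge> N" for m n
    proof -
      have "norm (op_poly (q m - q n) T) \<le> e / 2"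
      proof (rule norm_op_poly_le[OF T])
        fix x assume "x \<in> real_spectrum T"
        then have "\<bar>poly (q m) x - f x\<bar> < e / 4" "\<bar>poly (q n) x - f x\<bar> < e / 4"
          using N that C(2) by auto
        then show "\<bar>poly (q m - q n) x\<bar> \<le> e / 2" unfolding poly_diff by linarith
      qed (use e in simp)
      then show ?thesis using e by (simp add: dist_norm op_poly_diff)
    qed
    then show "\<exists>M. \<forall>m\<ge>M. \<forall>n\<ge>M. dist (op_poly (q m) T) (op_poly (q n) T) < e" by blast
  qed
  then obtain S where S: "(\<lambda>n. op_poly (q n) T) \<longlonglongrightarrow> S"
    using Cauchy_convergent convergent_def by blast
  then have "op_calc f T = S"
    using op_calc_eqI[OF T uniform_limit_on_subset[OF unif C(2)]] by blast
  then show thesis using that unif S by blast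
qed

lemma selfadjoint_op_calc:
  assumes "selfadjoint_op T" "compact C" "real_spectrum T \<subseteq> C" "continuous_on C f"
  shows "selfadjoint_op (op_calc f T)"
  by (rule op_calc_approx[OF assms]) (metis assms(1) selfadjoint_op_poly selfadjoint_limit)

lemma op_calc_poly:
  assumes "selfadjoint_op T" and "\<And>x. x \<in> real_spectrum T \<Longrightarrow> f x = poly q x"
  shows "op_calc f T = op_poly q T"
  by (rule op_calc_eqI[where q = "\<lambda>n. q"])
    (use assms in \<open>auto intro!: uniform_limitI\<close>)

lemma op_calc_mult:
  assumes T: "selfadjoint_op T" and C: "compact C" "real_spectrum T \<subseteq> C"
    and f: "continuous_on C f" and g: "continuous_on C g"
    and h: "\<And>x. x \<in> real_spectrum T \<Longrightarrow> h x = f x * g x"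
  shows "op_calc f T o\<^sub>L op_calc g T = op_calc h T"
proof -
  obtain q where q: "uniform_limit C (\<lambda>n. poly (q n)) f sequentially"
    "(\<lambda>n. op_poly (q n) T) \<longlonglongrightarrow> op_calc f T" by (rule op_calc_approx[OF T C f])
  obtain r where r: "uniform_limit C (\<lambda>n. poly (r n)) g sequentially"
    "(\<lambda>n. op_poly (r n) T) \<longlonglongrightarrow> op_calc g T" by (rule op_calc_approx[OF T C g])
  have "uniform_limit C (\<lambda>n x. poly (q n) x * poly (r n) x) (\<lambda>x. f x * g x) sequentially"
    by (intro uniform_lim_mult q r compact_imp_bounded compact_continuous_image f g C)
  then have "uniform_limit (real_spectrum T) (\<lambda>n x. poly (q n) x * poly (r n) x) (\<lambda>x. f x * g x) sequentially"
    using C(2) uniform_limit_on_subset by blast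
  then have "uniform_limit (real_spectrum T) (\<lambda>n. poly (q n * r n)) h sequentially"
    by (rule uniform_limit_cong'[THEN iffD1, rotated 2]) (simp_all add: h)
  moreover have "(\<lambda>n. op_poly (q n * r n) T) \<longlonglongrightarrow> (op_calc f T o\<^sub>L op_calc g T)"
    unfolding op_poly_mult by (intro blinfun_compose.tendsto q r)
  ultimately show ?thesis using op_calc_eqI[OF T] by metis
qed

lemma norm_op_calc_diff_le:
  assumes T: "selfadjoint_op T" and C: "compact C" "real_spectrum T \<subseteq> C"
    and f: "continuous_on C f" and g: "continuous_on C g"
    and e: "0 \<le> e" "\<And>x. x \<in> C \<Longrightarrow> \<bar>f x - g x\<bar> \<le> e"
  shows "norm (op_calc f T - op_calc g T) \<le> e"
proof (rule field_le_epsilon)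
  fix d :: real assume d: "d > 0"
  obtain q where q: "uniform_limit C (\<lambda>n. poly (q n)) f sequentially"
    "(\<lambda>n. op_poly (q n) T) \<longlonglongrightarrow> op_calc f T" by (rule op_calc_approx[OF T C f])
  obtain r where r: "uniform_limit C (\<lambda>n. poly (r n)) g sequentially"
    "(\<lambda>n. op_poly (r n) T) \<longlonglongrightarrow> op_calc g T" by (rule op_calc_approx[OF T C g])
  show "norm (op_calc f T - op_calc g T) \<le> e + d"
  proof (rule tendsto_upperbound)
    show "(\<lambda>n. norm (op_poly (q n - r n) T)) \<longlonglongrightarrow> norm (op_calc f T - op_calc g T)"
      unfolding op_poly_diff by (intro tendsto_intros q r)
    have "\<forall>\<^sub>F n in sequentially. \<forall>x\<in>C. dist (poly (q n) x) (f x) < d / 2"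
      "\<forall>\<^sub>F n in sequentially. \<forall>x\<in>C. dist (poly (r n) x) (g x) < d / 2"
      using uniform_limitD[OF q(1), of "d / 2"] uniform_limitD[OF r(1), of "d / 2"] d by simp_all
    then show "\<forall>\<^sub>F n in sequentially. norm (op_poly (q n - r n) T) \<le> e + d"
    proof eventually_elim
      case (elim n)
      show ?case
      proof (rule norm_op_poly_le[OF T])
        fix x assume "x \<in> real_spectrum T"
        then have x: "x \<in> C" using C(2) by blast
        then have "\<bar>poly (q n) x - f x\<bar> < d / 2" "\<bar>poly (r n) x - g x\<bar> < d / 2"
          using elim by (auto simp: dist_real_def)
        then show "\<bar>poly (q n - r n) x\<bar> \<le> e + d"
          using e(2)[OF x] unfolding poly_diff by linarith
      qed (use d e in simp)
    qed
  qed simp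
qed

text \<open>
  Outside the interval, \<open>T - r\<close> or \<open>r - T\<close> is coercive.
\<close>

lemma real_spectrum_subset_Icc:
  fixes T :: "'a::chilbert_space \<Rightarrow>\<^sub>L 'a"
  assumes T: "selfadjoint_op T" and d: "\<And>x. d * (norm x)\<^sup>2 \<le> rinner (T x) x"
  shows "real_spectrum T \<subseteq> {d..norm T}"
proof
  fix r assume r: "r \<in> real_spectrum T"
  have form: "rinner ((T - r *\<^sub>R id_blinfun) x) x = rinner (T x) x - r * (norm x)\<^sup>2" for x
    by (simp add: blinfun.diff_left blinfun.scaleR_left rinner.diff_left rinner.scaleR_left rinner_self)
  have sa: "selfadjoint_op (T - r *\<^sub>R id_blinfun)"
    by (intro selfadjoint_diff selfadjoint_scaleR selfadjoint_id T)
  have "d \<le> r"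
  proof (rule ccontr)
    assume "\<not> d \<le> r"
    then have "invertible_op (T - r *\<^sub>R id_blinfun)"
      by (intro coercive_op_invertible[OF sa, of "d - r"]) (simp_all add: form d left_diff_distrib)
    then show False using r by (simp add: real_spectrum_iff)
  qed
  moreover have "r \<le> norm T"
  proof (rule ccontr)
    assume *: "\<not> r \<le> norm T"
    have "(r - norm T) * (norm x)\<^sup>2 \<le> rinner ((- 1 *\<^sub>R (T - r *\<^sub>R id_blinfun)) x) x" for x
      using rinner_le_norm[of T x] form[of x]
      by (simp add: blinfun.minus_left rinner.minus_left left_diff_distrib del: minus_diff_eq)
    then have "invertible_op (- 1 *\<^sub>R (T - r *\<^sub>R id_blinfun))"
      using * by (intro coercive_op_invertible[OF selfadjoint_scaleR[OF sa], of "r - norm T"]) auto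
    then have "invertible_op (- 1 *\<^sub>R (- 1 *\<^sub>R (T - r *\<^sub>R id_blinfun)))"
      by (rule invertible_op_scaleR[OF _ selfadjoint_complex_linear[OF selfadjoint_scaleR[OF sa]]]) simp
    then show False using r by (simp add: real_spectrum_iff)
  qed
  ultimately show "r \<in> {d..norm T}" by simp
qed

section \<open>Real powers of invertible positive operators\<close>

lemma invertible_positive_selfadjoint: "T \<in> invertible_positive_ops \<Longrightarrow> selfadjoint_op T"
  by (simp add: invertible_positive_iff_coercive)

lemma invertible_positive_form_nonneg: "T \<in> invertible_positive_ops \<Longrightarrow> 0 \<le> rinner (T x) x"
  by (simp add: invertible_positive_ops_def positive_op_iff)

text \<open>
  The powers \<open>x powr p\<close> are continuous on such a set \<open>C\<close>, for negative \<open>p\<close> as well.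
\<close>

lemma invertible_positive_spectrum:
  assumes "T \<in> invertible_positive_ops"
  obtains C where "compact C" "real_spectrum T \<subseteq> C" "\<And>x. x \<in> C \<Longrightarrow> x > 0"
proof -
  obtain d where d: "d > 0" "\<And>x. d * (norm x)\<^sup>2 \<le> rinner (T x) x"
    using assms by (auto simp: invertible_positive_iff_coercive)
  show thesis
    by (rule that[of "{d..norm T}"])
      (use d real_spectrum_subset_Icc[OF invertible_positive_selfadjoint[OF assms] d(2)] in auto)
qed

lemma op_powr_add:
  assumes "T \<in> invertible_positive_ops"
  shows "op_powr T p o\<^sub>L op_powr T q = op_powr T (p + q)"
proof -
  obtain C where C: "compact C" "real_spectrum T \<subseteq> C" "\<And>x. x \<in> C \<Longrightarrow> x > 0"
    using invertible_positive_spectrum[OF assms] by blast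
  show ?thesis
    unfolding op_powr_def
    by (rule op_calc_mult[OF invertible_positive_selfadjoint[OF assms] C(1,2)])
      (use C(3) in \<open>auto intro!: continuous_intros simp: powr_add dest: less_imp_neq\<close>)
qed

lemma op_powr_zero: "T \<in> invertible_positive_ops \<Longrightarrow> op_powr T 0 = id_blinfun"
  and op_powr_one: "T \<in> invertible_positive_ops \<Longrightarrow> op_powr T 1 = T"
proof -
  assume T: "T \<in> invertible_positive_ops"
  obtain C where C: "compact C" "real_spectrum T \<subseteq> C" "\<And>x. x \<in> C \<Longrightarrow> x > 0"
    using invertible_positive_spectrum[OF T] by blast
  have pos: "x > 0" if "x \<in> real_spectrum T" for x using C that by auto
  show "op_powr T 0 = id_blinfun"
    unfolding op_powr_def
    by (subst op_calc_poly[of T _ "[:1:]"])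
      (use pos in \<open>auto simp: op_poly_const invertible_positive_selfadjoint T\<close>)
  show "op_powr T 1 = T"
    unfolding op_powr_def
    by (subst op_calc_poly[of T _ "[:0, 1:]"])
      (use pos in \<open>auto simp: op_poly_X invertible_positive_selfadjoint T less_imp_le\<close>)
qed

lemma selfadjoint_op_powr:
  assumes "T \<in> invertible_positive_ops"
  shows "selfadjoint_op (op_powr T p)"
proof -
  obtain C where C: "compact C" "real_spectrum T \<subseteq> C" "\<And>x. x \<in> C \<Longrightarrow> x > 0"
    using invertible_positive_spectrum[OF assms] by blast
  show ?thesis
    unfolding op_powr_def
    by (rule selfadjoint_op_calc[OF invertible_positive_selfadjoint[OF assms] C(1,2)])
      (use C(3) in \<open>auto intro!: continuous_intros dest: less_imp_neq\<close>)
qed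

lemma op_powr_inverse:
  assumes "T \<in> invertible_positive_ops"
  shows "op_powr T p o\<^sub>L op_powr T (-p) = id_blinfun" "op_powr T (-p) o\<^sub>L op_powr T p = id_blinfun"
  using op_powr_add[OF assms, of p "-p"] op_powr_add[OF assms, of "-p" p] op_powr_zero[OF assms] by auto

lemma invertible_op_powr: "T \<in> invertible_positive_ops \<Longrightarrow> invertible_op (op_powr T p)"
  by (meson invertible_opI op_powr_inverse selfadjoint_complex_linear selfadjoint_op_powr)

text \<open>
  A power is the square of the self-adjoint power with half the exponent.
\<close>

lemma op_powr_invertible_positive:
  assumes T: "T \<in> invertible_positive_ops"
  shows "op_powr T p \<in> invertible_positive_ops"
proof -
  have "0 \<le> rinner (op_powr T p x) x" for x
  proof -
    have "rinner (op_powr T p x) x = rinner (op_powr T (p/2) (op_powr T (p/2) x)) x"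
      using op_powr_add[OF T, of "p/2" "p/2"] by (simp flip: blinfun_apply_blinfun_compose)
    also have "\<dots> = (norm (op_powr T (p/2) x))\<^sup>2"
      using selfadjointD[OF selfadjoint_op_powr[OF T]] by (metis rinner_self)
    finally show ?thesis by simp
  qed
  then show ?thesis
    using selfadjoint_op_powr[OF T] invertible_op_powr[OF T]
    by (simp add: invertible_positive_ops_def positive_op_iff)
qed

text \<open>
  \<open>x powr p\<close> is uniformly continuous in the pair \<open>(p, x)\<close> on a compact rectangle, so powers with close
  exponents are uniformly close on the spectrum, and the operators are close in norm.
\<close>

lemma continuous_on_op_powr_Icc:
  assumes T: "T \<in> invertible_positive_ops"
  shows "continuous_on {a..b} (op_powr T)"
proof -
  obtain C where C: "compact C" "real_spectrum T \<subseteq> C" "\<And>x. x \<in> C \<Longrightarrow> x > 0"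
    using invertible_positive_spectrum[OF T] by blast
  have "uniformly_continuous_on ({a..b} \<times> C) (\<lambda>(p, x). x powr p)"
    unfolding case_prod_unfold
    by (intro compact_uniformly_continuous compact_Times C(1) compact_Icc continuous_intros)
      (use C(3) in \<open>auto dest: less_imp_neq\<close>)
  then have uc: "\<exists>d>0. \<forall>z\<in>{a..b} \<times> C. \<forall>z'\<in>{a..b} \<times> C.
      dist z' z < d \<longrightarrow> dist ((\<lambda>(p, x). x powr p) z') ((\<lambda>(p, x). x powr p) z) < e" if "e > 0" for e
    using that unfolding uniformly_continuous_on_def by blast
  show ?thesis
  proof (rule continuous_onI)
    fix p e :: real assume p: "p \<in> {a..b}" and e: "e > 0"
    obtain d where d: "d > 0" and D: "\<And>z z'. z \<in> {a..b} \<times> C \<Longrightarrow> z' \<in> {a..b} \<times> C \<Longrightarrow> dist z' z < d \<Longrightarrow>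
        dist ((\<lambda>(p, x). x powr p) z') ((\<lambda>(p, x). x powr p) z) < e"
      using uc[OF e] by blast
    have "dist (op_powr T p') (op_powr T p) \<le> e" if p': "p' \<in> {a..b}" "dist p' p < d" for p'
      unfolding op_powr_def dist_norm
    proof (rule norm_op_calc_diff_le[OF invertible_positive_selfadjoint[OF T] C(1,2)])
      show "\<bar>x powr p' - x powr p\<bar> \<le> e" if "x \<in> C" for x
        using D[of "(p, x)" "(p', x)"] p p' that by (simp add: dist_Pair_Pair dist_real_def)
    qed (use C(3) e in \<open>auto intro!: continuous_intros dest: less_imp_neq\<close>)
    then show "\<exists>d>0. \<forall>x'\<in>{a..b}. dist x' p < d \<longrightarrow> dist (op_powr T x') (op_powr T p) \<le> e"
      using d by blast
  qed
qed

lemma continuous_on_op_powr: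
  assumes "T \<in> invertible_positive_ops"
  shows "continuous_on S (op_powr T)"
proof -
  have "isCont (op_powr T) p" for p
    by (rule continuous_on_interior[OF continuous_on_op_powr_Icc[OF assms, of "p - 1" "p + 1"]]) simp
  then show ?thesis by (simp add: continuous_at_imp_continuous_on)
qed

section \<open>A Lyapunov inequality\<close>

text \<open>
  The hypothesis says that \<open>H S + S H\<close> is positive. Suppose that the bottom \<open>l\<close> of the form of \<open>H\<close>
  on unit vectors is negative, and let the form be close to \<open>l\<close> at a unit vector \<open>x\<close>. Then \<open>H x\<close> is
  close to \<open>l x\<close> in norm, by \<open>norm_square_le_of_positive\<close> for \<open>V = H - l\<close>, so that
  \<open>rinner (H x) (S x)\<close> is close to \<open>l * rinner (S x) x \<le> l * d < 0\<close>: a contradiction. The proof makes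
  this quantitative: no value of the form lies within \<open>e\<^sup>2 / M\<close> of its infimum.
\<close>

lemma positive_if_Lyapunov:
  assumes H: "selfadjoint_op H" and S: "S \<in> invertible_positive_ops"
    and L: "\<And>x. 0 \<le> rinner (H x) (S x)"
  shows "0 \<le> rinner (H x) x"
proof (rule ccontr)
  assume neg: "\<not> 0 \<le> rinner (H x) x"
  obtain d where d: "d > 0" "\<And>x. d * (norm x)\<^sup>2 \<le> rinner (S x) x"
    using S by (auto simp: invertible_positive_iff_coercive)
  define W where "W = (\<lambda>x. rinner (H x) x) ` {x. norm x = 1}"
  define l where "l = Inf W"
  have lower: "- norm H \<le> rinner (H x) x" if "norm x = 1" for x
    using rinner_Cauchy_Schwarz[of "H x" x] norm_blinfun[of H x] that by simp
  have bdd: "bdd_below W" unfolding W_def bdd_below_def using lower by blast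
  have scale: "rinner (H (r *\<^sub>R x)) (r *\<^sub>R x) = r\<^sup>2 * rinner (H x) x" for r x
    by (simp add: blinfun.scaleR_right rinner.scaleR_left rinner.scaleR_right power2_eq_square)
  have ge: "l * (norm x)\<^sup>2 \<le> rinner (H x) x" for x
  proof (cases "x = 0")
    case False
    then have "l \<le> rinner (H (inverse (norm x) *\<^sub>R x)) (inverse (norm x) *\<^sub>R x)"
      unfolding l_def by (intro cInf_lower bdd) (auto simp: W_def)
    then show ?thesis using False by (simp add: scale field_simps)
  qed (simp add: rinner.zero_left)
  have l: "l < 0"
  proof -
    have "l * (norm x)\<^sup>2 < 0" using ge[of x] neg by simp
    then show ?thesis by (simp add: mult_less_0_iff)
  qed
  have ne: "W \<noteq> {}"
  proof -
    have "x \<noteq> 0" using neg by (auto simp: rinner.zero_left)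
    then have "norm (inverse (norm x) *\<^sub>R x) = 1" by simp
    then show ?thesis unfolding W_def by blast
  qed
  define V where "V = H - l *\<^sub>R id_blinfun"
  have Vx: "V x = H x - l *\<^sub>R x" for x by (simp add: V_def blinfun.diff_left blinfun.scaleR_left)
  have Vform: "rinner (V x) x = rinner (H x) x - l * (norm x)\<^sup>2" for x
    by (simp add: Vx rinner.diff_left rinner.scaleR_left rinner_self)
  have "positive_op V"
    unfolding positive_op_iff Vform unfolding V_def
    using ge by (auto intro!: selfadjoint_diff selfadjoint_scaleR selfadjoint_id H)
  define M where "M = norm V + 1"
  define N where "N = norm S + 1"
  have MN: "M > 0" "N > 0" by (auto simp: M_def N_def add_nonneg_pos)
  have "rinner (V x) x \<le> M * (norm x)\<^sup>2" for x
    using rinner_le_norm[of V x] mult_right_mono[of "norm V" M "(norm x)\<^sup>2"] by (simp add: M_def)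
  then have Vsq: "(norm (V x))\<^sup>2 \<le> M * rinner (V x) x" for x
    using norm_square_le_of_positive[OF \<open>positive_op V\<close>] by blast
  define e where "e = - l * d / N"
  have e: "e > 0" using l d(1) MN(2) by (simp add: e_def divide_neg_pos mult_neg_pos)
  have "l + e\<^sup>2 / M \<le> w" if w: "w \<in> W" for w
  proof -
    obtain x where x: "norm x = 1" "w = rinner (H x) x" using w by (auto simp: W_def)
    have "rinner (H x) (S x) = rinner (V x) (S x) + l * rinner (S x) x"
      by (simp add: Vx rinner.diff_left rinner.scaleR_left rinner_commute[of x "S x"])
    moreover have "l * rinner (S x) x \<le> l * d"
      using d(2)[of x] l x by simp
    moreover have "rinner (V x) (S x) \<le> norm (V x) * N"
    proof -
      have "norm (S x) \<le> N" using norm_blinfun[of S x] x by (simp add: N_def)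
      then show ?thesis
        using rinner_Cauchy_Schwarz[of "V x" "S x"] mult_left_mono[of "norm (S x)" N "norm (V x)"] by simp
    qed
    ultimately have "- l * d \<le> norm (V x) * N" using L[of x] by simp
    then have "e \<le> norm (V x)" using MN by (simp add: e_def field_simps)
    then have "e\<^sup>2 \<le> (norm (V x))\<^sup>2" using e by (intro power_mono) auto
    also have "\<dots> \<le> M * (w - l)" using Vsq[of x] x by (simp add: Vform)
    finally show ?thesis using MN by (simp add: field_simps)
  qed
  then have "l + e\<^sup>2 / M \<le> l"
    unfolding l_def by (intro cInf_greatest ne) auto
  then show False using e MN by (simp add: divide_le_0_iff)
qed

section \<open>The Loewner order and weighted geometric means\<close>

lemma loewner_le_iff:
  "X \<preceq> Y \<longleftrightarrow> selfadjoint_op X \<and> selfadjoint_op Y \<and> (\<forall>x. rinner (X x) x \<le> rinner (Y x) x)"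
  by (auto simp: loewner_le_def positive_op_iff selfadjoint_diff blinfun.diff_left rinner.diff_left)

lemma loewner_trans: "X \<preceq> Y \<Longrightarrow> Y \<preceq> Z \<Longrightarrow> X \<preceq> Z"
  unfolding loewner_le_iff using order_trans by blast

lemma loewner_antisym:
  assumes "X \<preceq> Y" "Y \<preceq> X"
  shows "X = Y"
proof -
  have "positive_op (Y - X)" using assms(1) by (simp add: loewner_le_def)
  moreover have "rinner ((Y - X) x) x \<le> 0 * (norm x)\<^sup>2" for x
    using assms(2) by (simp add: loewner_le_iff blinfun.diff_left rinner.diff_left)
  ultimately have "(norm ((Y - X) x))\<^sup>2 \<le> 0 * rinner ((Y - X) x) x" for x
    by (rule norm_square_le_of_positive)
  then have "(Y - X) x = 0" for x by simp
  then show ?thesis by (intro blinfun_eqI) (simp add: blinfun.diff_left)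
qed

lemma sandwich_invertible_positive:
  assumes T: "T \<in> invertible_positive_ops" and K: "selfadjoint_op K" "invertible_op K"
  shows "K o\<^sub>L T o\<^sub>L K \<in> invertible_positive_ops"
proof -
  have "invertible_op (K o\<^sub>L T o\<^sub>L K)"
    using T K by (intro invertible_op_compose complex_linear_compose)
      (auto simp: invertible_positive_ops_def intro: selfadjoint_complex_linear invertible_positive_selfadjoint[OF T])
  moreover have "0 \<le> rinner ((K o\<^sub>L T o\<^sub>L K) x) x" for x
    using invertible_positive_form_nonneg[OF T, of "K x"] selfadjointD[OF K(1), of "T (K x)" x] by simp
  ultimately show ?thesis
    by (simp add: invertible_positive_ops_def positive_op_iff selfadjoint_sandwich[OF K(1) invertible_positive_selfadjoint[OF T]])
qed

lemma sum_invertible_positive: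
  assumes "finite I" "I \<noteq> {}" "\<And>i. i \<in> I \<Longrightarrow> f i \<in> invertible_positive_ops"
  shows "(\<Sum>i\<in>I. f i) \<in> invertible_positive_ops"
  using assms
proof (induction rule: finite_ne_induct)
  case (insert i I)
  then have i: "f i \<in> invertible_positive_ops" and I: "sum f I \<in> invertible_positive_ops" by auto
  obtain d where d: "d > 0" "\<And>x. d * (norm x)\<^sup>2 \<le> rinner (f i x) x"
    using i by (auto simp: invertible_positive_iff_coercive)
  have "d * (norm x)\<^sup>2 \<le> rinner ((f i + sum f I) x) x" for x
    using d(2)[of x] invertible_positive_form_nonneg[OF I, of x]
    by (simp add: blinfun.add_left rinner.add_left)
  then show ?case
    using insert d(1) selfadjoint_add[OF i[THEN invertible_positive_selfadjoint] I[THEN invertible_positive_selfadjoint]]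
    by (auto simp: invertible_positive_iff_coercive)
qed simp

lemma op_powr_minus_one_eqI:
  assumes "T \<in> invertible_positive_ops" and "T o\<^sub>L S = id_blinfun"
  shows "op_powr T (-1) = S"
  by (metis assms blinfun_compose_assoc blinfun_compose_id op_powr_inverse(2) op_powr_one)

text \<open>
  In terms of \<open>T = relative_op A B\<close>, the curve of weighted means is \<open>p \<mapsto> A\<^bsup>1/2\<^esup> T\<^bsup>p\<^esup> A\<^bsup>1/2\<^esup>\<close>. Computations
  along this curve amount to the addition of exponents of the two operators \<open>A\<close> and \<open>T\<close>.
\<close>

definition relative_op :: "('a::chilbert_space \<Rightarrow>\<^sub>L 'a) \<Rightarrow> ('a \<Rightarrow>\<^sub>L 'a) \<Rightarrow> ('a \<Rightarrow>\<^sub>L 'a)" where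
  "relative_op A B = op_powr A (-1/2) o\<^sub>L B o\<^sub>L op_powr A (-1/2)"

lemma wgmean_apply:
  "(A \<sharp>\<^bsub>p\<^esub> B) x = op_powr A (1/2) (op_powr (relative_op A B) p (op_powr A (1/2) x))"
  by (simp add: wgmean_def relative_op_def)

lemma op_powr_apply_add:
  assumes "T \<in> invertible_positive_ops"
  shows "op_powr T p (op_powr T q x) = op_powr T (p + q) x"
  using op_powr_add[OF assms, of p q] by (simp flip: blinfun_apply_blinfun_compose)

lemma relative_op_invertible_positive:
  assumes "A \<in> invertible_positive_ops" "B \<in> invertible_positive_ops"
  shows "relative_op A B \<in> invertible_positive_ops"
  unfolding relative_op_def
  by (intro sandwich_invertible_positive assms selfadjoint_op_powr invertible_op_powr)

lemma wgmean_invertible_positive: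
  assumes "A \<in> invertible_positive_ops" "B \<in> invertible_positive_ops"
  shows "A \<sharp>\<^bsub>p\<^esub> B \<in> invertible_positive_ops"
  unfolding wgmean_def relative_op_def[symmetric]
  by (intro sandwich_invertible_positive op_powr_invertible_positive relative_op_invertible_positive
      assms selfadjoint_op_powr invertible_op_powr)

lemma wgmean_zero:
  assumes "A \<in> invertible_positive_ops" "B \<in> invertible_positive_ops"
  shows "A \<sharp>\<^bsub>0\<^esub> B = A"
  by (rule blinfun_eqI)
    (simp add: wgmean_apply op_powr_zero relative_op_invertible_positive op_powr_apply_add op_powr_one assms)

lemma wgmean_one:
  assumes "A \<in> invertible_positive_ops" "B \<in> invertible_positive_ops"
  shows "A \<sharp>\<^bsub>1\<^esub> B = B"
  by (rule blinfun_eqI)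
    (simp add: wgmean_apply op_powr_one relative_op_invertible_positive assms,
      simp add: relative_op_def op_powr_apply_add op_powr_zero assms)

lemma continuous_on_wgmean:
  assumes "A \<in> invertible_positive_ops" "B \<in> invertible_positive_ops"
  shows "continuous_on S (\<lambda>p. A \<sharp>\<^bsub>p\<^esub> B)"
  unfolding wgmean_def relative_op_def[symmetric]
  by (intro blinfun_compose.continuous_on continuous_on_const continuous_on_op_powr
      relative_op_invertible_positive assms)

section \<open>The geometric mean as a greatest block completion\<close>

text \<open>
  Positivity of the operator matrix with rows \<open>(A, X)\<close> and \<open>(X, B)\<close>, as a quadratic form on pairs
  \<open>(x, y)\<close>. The condition is additive in \<open>(A, X, B)\<close> and monotone in \<open>A\<close> and \<open>B\<close>.
\<close>

definition block_nonneg ::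
  "('a::chilbert_space \<Rightarrow>\<^sub>L 'a) \<Rightarrow> ('a \<Rightarrow>\<^sub>L 'a) \<Rightarrow> ('a \<Rightarrow>\<^sub>L 'a) \<Rightarrow> bool" where
  "block_nonneg A X B \<longleftrightarrow> (\<forall>x y. 0 \<le> rinner (A x) x + 2 * rinner (X y) x + rinner (B y) y)"

text \<open>
  Completing the square: if \<open>B = X A\<^bsup>-1\<^esup> X\<close>, the form at \<open>(x, y)\<close> is the form of \<open>A\<close> at
  \<open>x + A\<^bsup>-1\<^esup> X y\<close>.
\<close>

lemma block_nonneg_if_Riccati:
  assumes A: "A \<in> invertible_positive_ops" and X: "selfadjoint_op X"
    and eq: "X o\<^sub>L op_powr A (-1) o\<^sub>L X = B"
  shows "block_nonneg A X B"
  unfolding block_nonneg_def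
proof (intro allI)
  fix x y
  define z where "z = op_powr A (-1) (X y)"
  have Az: "A z = X y"
    using op_powr_apply_add[OF A, of 1 "-1" "X y"] A by (simp add: z_def op_powr_one op_powr_zero)
  have "B y = X z" using eq by (auto simp: z_def)
  then have "rinner (A x) x + 2 * rinner (X y) x + rinner (B y) y = rinner (A (x + z)) (x + z)"
    using selfadjointD[OF X, of z y] selfadjointD[OF invertible_positive_selfadjoint[OF A], of x z]
    by (simp add: blinfun.add_right rinner.add_left rinner.add_right Az rinner_commute)
  then show "0 \<le> rinner (A x) x + 2 * rinner (X y) x + rinner (B y) y"
    using invertible_positive_form_nonneg[OF A] by simp
qed

text \<open>
  The vector \<open>(A\<^bsup>-1\<^esup> X w, - w)\<close> is isotropic for the block form with the solution \<open>X\<close> itself.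
  Evaluating the form with \<open>Y\<close> there gives \<open>0 \<le> rinner ((X - Y) w) (A\<^bsup>-1\<^esup> X w)\<close>. Conjugation by
  \<open>Q = A\<^bsup>-1/2\<^esup>\<close> turns \<open>A\<^bsup>-1\<^esup> X\<close> into the invertible positive operator \<open>Q X Q\<close>, after which
  \<open>positive_if_Lyapunov\<close> applies to \<open>Q (X - Y) Q\<close>.
\<close>

lemma Riccati_solution_maximal:
  assumes A: "A \<in> invertible_positive_ops" and X: "X \<in> invertible_positive_ops"
    and eq: "X o\<^sub>L op_powr A (-1) o\<^sub>L X = B"
    and Y: "selfadjoint_op Y" and block: "block_nonneg A Y B"
  shows "Y \<preceq> X"
proof -
  note saX = invertible_positive_selfadjoint[OF X]
  define Q where "Q = op_powr A (-1/2)"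
  define P where "P = op_powr A (1/2)"
  have Q: "selfadjoint_op Q" "invertible_op Q"
    unfolding Q_def by (intro selfadjoint_op_powr invertible_op_powr A)+
  have QQ: "Q (Q x) = op_powr A (-1) x" and QP: "Q (P x) = x" for x
    using op_powr_apply_add[OF A] by (simp_all add: Q_def P_def op_powr_zero A)
  define D where "D = X - Y"
  have D: "selfadjoint_op D" unfolding D_def by (intro selfadjoint_diff saX Y)
  have Lyapunov: "0 \<le> rinner (D w) (op_powr A (-1) (X w))" for w
  proof -
    define z where "z = op_powr A (-1) (X w)"
    have Az: "A z = X w"
      using op_powr_apply_add[OF A, of 1 "-1" "X w"] A by (simp add: z_def op_powr_one op_powr_zero)
    have "B w = X z" using eq by (auto simp: z_def)
    then have "rinner (B w) w = rinner (X w) z"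
      using selfadjointD[OF saX, of z w] by (simp add: rinner_commute)
    moreover have "0 \<le> rinner (A z) z + 2 * rinner (Y (- w)) z + rinner (B (- w)) (- w)"
      using block by (auto simp: block_nonneg_def)
    ultimately have "0 \<le> 2 * rinner (X w) z - 2 * rinner (Y w) z"
      by (simp add: Az blinfun.minus_right rinner.minus_left rinner.minus_right)
    then show ?thesis by (simp add: D_def z_def[symmetric] blinfun.diff_left rinner.diff_left)
  qed
  have QDQ: "0 \<le> rinner ((Q o\<^sub>L D o\<^sub>L Q) x) x" for x
  proof (rule positive_if_Lyapunov)
    show "selfadjoint_op (Q o\<^sub>L D o\<^sub>L Q)" by (intro selfadjoint_sandwich Q D)
    show "Q o\<^sub>L X o\<^sub>L Q \<in> invertible_positive_ops" by (intro sandwich_invertible_positive Q X)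
    show "0 \<le> rinner ((Q o\<^sub>L D o\<^sub>L Q) x) ((Q o\<^sub>L X o\<^sub>L Q) x)" for x
      using Lyapunov[of "Q x"] selfadjointD[OF Q(1), of "D (Q x)"] by (simp add: QQ)
  qed
  have "0 \<le> rinner (D x) x" for x
    using QDQ[of "P x"] selfadjointD[OF Q(1), of "D x" "P x"] by (simp add: QP)
  then show ?thesis
    using saX Y by (simp add: loewner_le_iff D_def blinfun.diff_left rinner.diff_left)
qed

lemma gmean_Riccati:
  assumes A: "A \<in> invertible_positive_ops" and B: "B \<in> invertible_positive_ops"
  shows "(A \<sharp> B) o\<^sub>L op_powr A (-1) o\<^sub>L (A \<sharp> B) = B"
proof (rule blinfun_eqI)
  fix x
  have "((A \<sharp> B) o\<^sub>L op_powr A (-1) o\<^sub>L (A \<sharp> B)) x = (A \<sharp>\<^bsub>1\<^esub> B) x"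
    by (simp add: wgmean_apply op_powr_apply_add A B relative_op_invertible_positive op_powr_zero)
  then show "((A \<sharp> B) o\<^sub>L op_powr A (-1) o\<^sub>L (A \<sharp> B)) x = B x"
    using wgmean_one[OF A B] by simp
qed

lemma gmean_greatest:
  assumes "A \<in> invertible_positive_ops" "B \<in> invertible_positive_ops"
    and "selfadjoint_op Y" "block_nonneg A Y B"
  shows "Y \<preceq> A \<sharp> B"
  by (rule Riccati_solution_maximal[OF assms(1) wgmean_invertible_positive[OF assms(1,2)]
        gmean_Riccati[OF assms(1,2)] assms(3,4)])

lemma block_nonneg_gmean:
  assumes "A \<in> invertible_positive_ops" "B \<in> invertible_positive_ops"
  shows "block_nonneg A (A \<sharp> B) B"
  by (intro block_nonneg_if_Riccati gmean_Riccati invertible_positive_selfadjoint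
      wgmean_invertible_positive assms)

text \<open>
  Both \<open>A \<sharp> B\<close> and \<open>X\<close> solve the Riccati equation, hence both are the greatest block completion.
\<close>

lemma gmean_eqI:
  assumes A: "A \<in> invertible_positive_ops" and B: "B \<in> invertible_positive_ops"
    and X: "X \<in> invertible_positive_ops" and eq: "X o\<^sub>L op_powr A (-1) o\<^sub>L X = B"
  shows "A \<sharp> B = X"
proof (rule loewner_antisym)
  show "A \<sharp> B \<preceq> X"
    by (rule Riccati_solution_maximal[OF A X eq])
      (intro block_nonneg_gmean invertible_positive_selfadjoint wgmean_invertible_positive A B)+
  show "X \<preceq> A \<sharp> B"
    by (intro gmean_greatest A B block_nonneg_if_Riccati[OF A _ eq] invertible_positive_selfadjoint[OF X])
qed

lemma gmean_mono:
  assumes P: "A \<in> invertible_positive_ops" "B \<in> invertible_positive_ops"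
    "A' \<in> invertible_positive_ops" "B' \<in> invertible_positive_ops"
    and le: "A \<preceq> A'" "B \<preceq> B'"
  shows "A \<sharp> B \<preceq> A' \<sharp> B'"
proof (rule gmean_greatest[OF P(3,4)])
  show "selfadjoint_op (A \<sharp> B)"
    by (intro invertible_positive_selfadjoint wgmean_invertible_positive P)
  show "block_nonneg A' (A \<sharp> B) B'"
    unfolding block_nonneg_def
  proof (intro allI)
    fix x y
    have "0 \<le> rinner (A x) x + 2 * rinner ((A \<sharp> B) y) x + rinner (B y) y"
      using block_nonneg_gmean[OF P(1,2)] by (simp add: block_nonneg_def)
    moreover have "rinner (A x) x \<le> rinner (A' x) x" "rinner (B y) y \<le> rinner (B' y) y"
      using le by (simp_all add: loewner_le_iff)
    ultimately show "0 \<le> rinner (A' x) x + 2 * rinner ((A \<sharp> B) y) x + rinner (B' y) y"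
      by linarith
  qed
qed

lemma gmean_superadditive:
  assumes I: "finite I" "I \<noteq> {}" and A: "\<And>j. j \<in> I \<Longrightarrow> A j \<in> invertible_positive_ops"
    and B: "\<And>j. j \<in> I \<Longrightarrow> B j \<in> invertible_positive_ops"
  shows "(\<Sum>j\<in>I. A j \<sharp> B j) \<preceq> (\<Sum>j\<in>I. A j) \<sharp> (\<Sum>j\<in>I. B j)"
proof (rule gmean_greatest)
  show "block_nonneg (\<Sum>j\<in>I. A j) (\<Sum>j\<in>I. A j \<sharp> B j) (\<Sum>j\<in>I. B j)"
    unfolding block_nonneg_def
  proof (intro allI)
    fix x y
    have "0 \<le> (\<Sum>j\<in>I. rinner (A j x) x + 2 * rinner ((A j \<sharp> B j) y) x + rinner (B j y) y)"
      using block_nonneg_gmean[OF A B] by (intro sum_nonneg) (simp add: block_nonneg_def)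
    then show "0 \<le> rinner ((\<Sum>j\<in>I. A j) x) x + 2 * rinner ((\<Sum>j\<in>I. A j \<sharp> B j) y) x
        + rinner ((\<Sum>j\<in>I. B j) y) y"
      by (simp add: blinfun.sum_left rinner.sum_left sum.distrib sum_distrib_left)
  qed
qed (intro sum_invertible_positive selfadjoint_sum invertible_positive_selfadjoint
    wgmean_invertible_positive I A B; assumption)+

text \<open>
  With \<open>T = relative_op A B\<close> and \<open>r = (p + q) / 2\<close>, the Riccati equation reduces to
  \<open>T\<^bsup>r\<^esup> T\<^bsup>-p\<^esup> T\<^bsup>r\<^esup> = T\<^bsup>q\<^esup>\<close>; here \<open>J\<close> is the inverse of \<open>A \<sharp>\<^bsub>p\<^esub> B\<close>.
\<close>

lemma gmean_wgmean_midpoint: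
  assumes A: "A \<in> invertible_positive_ops" and B: "B \<in> invertible_positive_ops"
  shows "(A \<sharp>\<^bsub>p\<^esub> B) \<sharp> (A \<sharp>\<^bsub>q\<^esub> B) = A \<sharp>\<^bsub>(p + q) / 2\<^esub> B"
proof (rule gmean_eqI)
  define T where "T = relative_op A B"
  have T: "T \<in> invertible_positive_ops"
    unfolding T_def by (intro relative_op_invertible_positive A B)
  define Q where "Q = op_powr A (-1/2)"
  define J where "J = Q o\<^sub>L op_powr T (-p) o\<^sub>L Q"
  note simps = wgmean_apply T_def[symmetric] op_powr_apply_add[OF A] op_powr_apply_add[OF T]
    op_powr_zero[OF A] op_powr_zero[OF T]
  have "(A \<sharp>\<^bsub>p\<^esub> B) o\<^sub>L J = id_blinfun"
    by (rule blinfun_eqI) (simp add: simps J_def Q_def)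
  then have inv: "op_powr (A \<sharp>\<^bsub>p\<^esub> B) (-1) = J"
    by (intro op_powr_minus_one_eqI wgmean_invertible_positive A B)
  have "(p + q) / 2 + (- p + (p + q) / 2) = q" by (simp add: field_simps)
  then show "(A \<sharp>\<^bsub>(p + q) / 2\<^esub> B) o\<^sub>L op_powr (A \<sharp>\<^bsub>p\<^esub> B) (-1) o\<^sub>L (A \<sharp>\<^bsub>(p + q) / 2\<^esub> B) = A \<sharp>\<^bsub>q\<^esub> B"
    by (intro blinfun_eqI) (simp add: inv simps J_def Q_def)
qed (intro wgmean_invertible_positive A B)+

section \<open>Log-convexity of sums of weighted means\<close>

text \<open>
  A point of \<open>[0, 1]\<close> outside \<open>S\<close> would lie in a gap between two points of \<open>S\<close>, but the midpoint of the gap is in \<open>S\<close>.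
\<close>

lemma closed_midpoint_closed_contains_interval:
  fixes S :: "real set"
  assumes S: "closed S" and end_points: "0 \<in> S" "1 \<in> S"
    and mid: "\<And>a b. a \<in> S \<Longrightarrow> b \<in> S \<Longrightarrow> (a + b) / 2 \<in> S"
  shows "{0..1} \<subseteq> S"
proof
  fix r :: real assume r: "r \<in> {0..1}"
  show "r \<in> S"
  proof (rule ccontr)
    assume notin: "r \<notin> S"
    define a where "a = Sup (S \<inter> {0..r})"
    define b where "b = Inf (S \<inter> {r..1})"
    have bdd: "bdd_above (S \<inter> {0..r})" "bdd_below (S \<inter> {r..1})" by auto
    have a: "a \<in> S \<inter> {0..r}"
      unfolding a_def using end_points r S by (intro closed_contains_Sup bdd closed_Int) auto
    have b: "b \<in> S \<inter> {r..1}"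
      unfolding b_def using end_points r S by (intro closed_contains_Inf bdd closed_Int) auto
    have lt: "a < r" "r < b" using a b notin by (auto simp: order_less_le)
    have m: "(a + b) / 2 \<in> S" using mid a b by blast
    show False
    proof (cases "(a + b) / 2 \<le> r")
      case True
      then have "(a + b) / 2 \<le> a"
        unfolding a_def[symmetric] using a b m lt
        by (subst a_def, intro cSup_upper bdd) auto
      then show False using lt by simp
    next
      case False
      then have "b \<le> (a + b) / 2"
        using a b m lt by (subst b_def, intro cInf_lower bdd) auto
      then show False using lt by simp
    qed
  qed
qed

text \<open>
  The inequality is an equality for \<open>r = 0\<close> and \<open>r = 1\<close>. If it holds for \<open>a\<close> and \<open>b\<close> then it holds for
  \<open>(a + b) / 2\<close>: both sides at the midpoint are geometric means of their values at \<open>a\<close> and \<open>b\<close>, for the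
  left side termwise before the summation, and \<open>\<sharp>\<close> is superadditive and monotone. Both sides are
  norm-continuous in \<open>r\<close>, so the inequality spreads to all of \<open>[0, 1]\<close>.
\<close>

lemma sum_wgmean_log_convex:
  assumes I: "finite I" "I \<noteq> {}" and A: "\<And>j. j \<in> I \<Longrightarrow> A j \<in> invertible_positive_ops"
    and B: "\<And>j. j \<in> I \<Longrightarrow> B j \<in> invertible_positive_ops" and r: "r \<in> {0..1}"
  shows "(\<Sum>j\<in>I. A j \<sharp>\<^bsub>(1 - r) * u + r * v\<^esub> B j)
    \<preceq> (\<Sum>j\<in>I. A j \<sharp>\<^bsub>u\<^esub> B j) \<sharp>\<^bsub>r\<^esub> (\<Sum>j\<in>I. A j \<sharp>\<^bsub>v\<^esub> B j)"
proof -
  define S where "S p = (\<Sum>j\<in>I. A j \<sharp>\<^bsub>p\<^esub> B j)" for p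
  have S: "S p \<in> invertible_positive_ops" for p
    unfolding S_def by (intro sum_invertible_positive wgmean_invertible_positive I A B; assumption)
  define X where "X r = S ((1 - r) * u + r * v)" for r
  define Y where "Y r = S u \<sharp>\<^bsub>r\<^esub> S v" for r
  have X: "X r \<in> invertible_positive_ops" and Y: "Y r \<in> invertible_positive_ops" for r
    unfolding X_def Y_def by (intro S wgmean_invertible_positive)+
  note sa = invertible_positive_selfadjoint
  define G where "G = {r. X r \<preceq> Y r}"
  have "closed G"
  proof -
    have "continuous_on UNIV S"
      unfolding S_def by (intro continuous_on_sum continuous_on_wgmean A B; assumption)
    then have contX: "continuous_on UNIV X"
      unfolding X_def by (rule continuous_on_compose2) (auto intro!: continuous_intros)
    have contY: "continuous_on UNIV Y"
      unfolding Y_def by (intro continuous_on_wgmean S)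
    have "closed {r. rinner (X r x) x \<le> rinner (Y r x) x}" for x
      by (intro closed_Collect_le rinner.continuous_on blinfun.continuous_on contX contY continuous_on_const)
    then have "closed (\<Inter>x. {r. rinner (X r x) x \<le> rinner (Y r x) x})" by blast
    moreover have "G = (\<Inter>x. {r. rinner (X r x) x \<le> rinner (Y r x) x})"
      by (auto simp: G_def loewner_le_iff sa[OF X] sa[OF Y])
    ultimately show ?thesis by simp
  qed
  moreover have "0 \<in> G" "1 \<in> G"
    using wgmean_zero[OF S S] wgmean_one[OF S S]
    by (auto simp: G_def X_def Y_def loewner_le_iff sa[OF S])
  moreover have "(a + b) / 2 \<in> G" if "a \<in> G" "b \<in> G" for a b
  proof -
    have "((1 - a) * u + a * v + ((1 - b) * u + b * v)) / 2 = (1 - (a + b) / 2) * u + (a + b) / 2 * v"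
      by (simp add: field_simps)
    then have "(A j \<sharp>\<^bsub>(1 - a) * u + a * v\<^esub> B j) \<sharp> (A j \<sharp>\<^bsub>(1 - b) * u + b * v\<^esub> B j)
        = A j \<sharp>\<^bsub>(1 - (a + b) / 2) * u + (a + b) / 2 * v\<^esub> B j" if "j \<in> I" for j
      using gmean_wgmean_midpoint[OF A[OF that] B[OF that]] by metis
    then have "X ((a + b) / 2) = (\<Sum>j\<in>I. (A j \<sharp>\<^bsub>(1 - a) * u + a * v\<^esub> B j) \<sharp> (A j \<sharp>\<^bsub>(1 - b) * u + b * v\<^esub> B j))"
      unfolding X_def S_def by simp
    also have "\<dots> \<preceq> X a \<sharp> X b"
      unfolding X_def S_def by (intro gmean_superadditive wgmean_invertible_positive I A B; assumption)
    finally have "X ((a + b) / 2) \<preceq> X a \<sharp> X b" .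
    moreover have "X a \<sharp> X b \<preceq> Y a \<sharp> Y b"
      using that by (intro gmean_mono X Y) (auto simp: G_def)
    moreover have "Y a \<sharp> Y b = Y ((a + b) / 2)"
      unfolding Y_def by (intro gmean_wgmean_midpoint S)
    ultimately show ?thesis unfolding G_def using loewner_trans by auto
  qed
  ultimately have "{0..1} \<subseteq> G" by (intro closed_midpoint_closed_contains_interval) auto
  then show ?thesis using r by (auto simp: G_def X_def Y_def S_def)
qed

text \<open>
  Both \<open>s\<close> and \<open>1 - s\<close> lie on the segment from \<open>t\<close> to \<open>1 - t\<close>, with parameters \<open>r\<close> and \<open>1 - r\<close>. By
  log-convexity the two sums on the left lie below the weighted means, with weights \<open>r\<close> and \<open>1 - r\<close>,
  of the two sums on the right, and the geometric mean of these weighted means is the unweighted one.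
\<close>

lemma gmean_sum_wgmean_le:
  assumes I: "finite I" "I \<noteq> {}" and A: "\<And>j. j \<in> I \<Longrightarrow> A j \<in> invertible_positive_ops"
    and B: "\<And>j. j \<in> I \<Longrightarrow> B j \<in> invertible_positive_ops"
    and s: "s \<in> {min t (1 - t)..max t (1 - t)}"
  shows "(\<Sum>j\<in>I. A j \<sharp>\<^bsub>s\<^esub> B j) \<sharp> (\<Sum>j\<in>I. A j \<sharp>\<^bsub>1 - s\<^esub> B j)
    \<preceq> (\<Sum>j\<in>I. A j \<sharp>\<^bsub>t\<^esub> B j) \<sharp> (\<Sum>j\<in>I. A j \<sharp>\<^bsub>1 - t\<^esub> B j)"
proof -
  define S where "S p = (\<Sum>j\<in>I. A j \<sharp>\<^bsub>p\<^esub> B j)" for p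
  have S: "S p \<in> invertible_positive_ops" for p
    unfolding S_def by (intro sum_invertible_positive wgmean_invertible_positive I A B; assumption)
  have convex: "S ((1 - r) * t + r * (1 - t)) \<preceq> S t \<sharp>\<^bsub>r\<^esub> S (1 - t)" if "r \<in> {0..1}" for r
    unfolding S_def by (rule sum_wgmean_log_convex[OF I A B that])
  obtain r where r: "r \<in> {0..1}" "s = (1 - r) * t + r * (1 - t)"
  proof (cases "t = 1 / 2")
    case True
    then show ?thesis using that[of 0] s by (simp add: min_def max_def)
  next
    case False
    define r where "r = (s - t) / (1 - 2 * t)"
    have "r * (1 - 2 * t) = s - t" using False by (simp add: r_def)
    moreover have "0 \<le> r \<and> r \<le> 1"
      unfolding r_def using False s by (auto simp: field_simps min_def max_def split: if_splits)
    ultimately show ?thesis using that[of r] by (simp add: algebra_simps)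
  qed
  have "1 - s = (1 - (1 - r)) * t + (1 - r) * (1 - t)" using r(2) by (simp add: algebra_simps)
  then have "S s \<preceq> S t \<sharp>\<^bsub>r\<^esub> S (1 - t)" "S (1 - s) \<preceq> S t \<sharp>\<^bsub>1 - r\<^esub> S (1 - t)"
    using convex[of r] convex[of "1 - r"] r by auto
  then have "S s \<sharp> S (1 - s) \<preceq> (S t \<sharp>\<^bsub>r\<^esub> S (1 - t)) \<sharp> (S t \<sharp>\<^bsub>1 - r\<^esub> S (1 - t))"
    by (intro gmean_mono S wgmean_invertible_positive)
  also have "\<dots> = S t \<sharp> S (1 - t)" by (subst gmean_wgmean_midpoint[OF S S]) simp
  finally show ?thesis by (simp add: S_def)
qed

theorem corollary2p2:
  fixes A B :: "nat \<Rightarrow> ('a::chilbert_space \<Rightarrow>\<^sub>L 'a)" and m :: nat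
  assumes "m \<ge> 1"
    and "\<And>j. j \<in> {1..m} \<Longrightarrow> A j \<in> invertible_positive_ops"
    and "\<And>j. j \<in> {1..m} \<Longrightarrow> B j \<in> invertible_positive_ops"
  shows "(\<forall>s::real \<in> {0..1}.
      (\<Sum>j=1..m. A j \<sharp> B j)
        \<preceq> (\<Sum>j=1..m. A j \<sharp>\<^bsub>s\<^esub> B j) \<sharp> (\<Sum>j=1..m. A j \<sharp>\<^bsub>1 - s\<^esub> B j) \<and>
      (\<Sum>j=1..m. A j \<sharp>\<^bsub>s\<^esub> B j) \<sharp> (\<Sum>j=1..m. A j \<sharp>\<^bsub>1 - s\<^esub> B j)
        \<preceq> (\<Sum>j=1..m. A j) \<sharp> (\<Sum>j=1..m. B j)) \<and>
    (\<forall>t::real \<in> {0..1}. \<forall>s \<in> {min t (1 - t)..max t (1 - t)}.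
      (\<Sum>j=1..m. A j \<sharp>\<^bsub>s\<^esub> B j) \<sharp> (\<Sum>j=1..m. A j \<sharp>\<^bsub>1 - s\<^esub> B j)
        \<preceq> (\<Sum>j=1..m. A j \<sharp>\<^bsub>t\<^esub> B j) \<sharp> (\<Sum>j=1..m. A j \<sharp>\<^bsub>1 - t\<^esub> B j))"
proof (intro conjI ballI)
  have I: "finite {1..m}" "{1..m} \<noteq> {}" using assms(1) by auto
  fix s :: real assume s: "s \<in> {0..1}"
  have "(\<Sum>j=1..m. A j \<sharp> B j) = (\<Sum>j=1..m. (A j \<sharp>\<^bsub>s\<^esub> B j) \<sharp> (A j \<sharp>\<^bsub>1 - s\<^esub> B j))"
    by (intro sum.cong) (simp_all add: gmean_wgmean_midpoint assms)
  also have "\<dots> \<preceq> (\<Sum>j=1..m. A j \<sharp>\<^bsub>s\<^esub> B j) \<sharp> (\<Sum>j=1..m. A j \<sharp>\<^bsub>1 - s\<^esub> B j)"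
    by (intro gmean_superadditive wgmean_invertible_positive I assms(2,3))
  finally show "(\<Sum>j=1..m. A j \<sharp> B j)
      \<preceq> (\<Sum>j=1..m. A j \<sharp>\<^bsub>s\<^esub> B j) \<sharp> (\<Sum>j=1..m. A j \<sharp>\<^bsub>1 - s\<^esub> B j)" .
  have "(\<Sum>j=1..m. A j \<sharp>\<^bsub>0\<^esub> B j) = (\<Sum>j=1..m. A j)" "(\<Sum>j=1..m. A j \<sharp>\<^bsub>1 - 0\<^esub> B j) = (\<Sum>j=1..m. B j)"
    by (intro sum.cong; simp add: wgmean_zero wgmean_one assms)+
  \<comment> \<open>The upper bound is the extreme case \<open>t = 0\<close> of the monotonicity in the second part.\<close>
  moreover have "(\<Sum>j=1..m. A j \<sharp>\<^bsub>s\<^esub> B j) \<sharp> (\<Sum>j=1..m. A j \<sharp>\<^bsub>1 - s\<^esub> B j)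
      \<preceq> (\<Sum>j=1..m. A j \<sharp>\<^bsub>0\<^esub> B j) \<sharp> (\<Sum>j=1..m. A j \<sharp>\<^bsub>1 - 0\<^esub> B j)"
    by (rule gmean_sum_wgmean_le[OF I assms(2,3)]) (use s in auto)
  ultimately show "(\<Sum>j=1..m. A j \<sharp>\<^bsub>s\<^esub> B j) \<sharp> (\<Sum>j=1..m. A j \<sharp>\<^bsub>1 - s\<^esub> B j)
      \<preceq> (\<Sum>j=1..m. A j) \<sharp> (\<Sum>j=1..m. B j)"
    by simp
next
  have I: "finite {1..m}" "{1..m} \<noteq> {}" using assms(1) by auto
  fix t s :: real assume s: "s \<in> {min t (1 - t)..max t (1 - t)}"
  show "(\<Sum>j=1..m. A j \<sharp>\<^bsub>s\<^esub> B j) \<sharp> (\<Sum>j=1..m. A j \<sharp>\<^bsub>1 - s\<^esub> B j)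
      \<preceq> (\<Sum>j=1..m. A j \<sharp>\<^bsub>t\<^esub> B j) \<sharp> (\<Sum>j=1..m. A j \<sharp>\<^bsub>1 - t\<^esub> B j)"
    by (rule gmean_sum_wgmean_le[OF I assms(2,3) s])
qed

end
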